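(* Let $T_3$ be the $3$-regular infinite tree, let $X_v$, $v \in V(T_3)$, be the Gaussian wave function on $T_3$ with eigenvalue $\lambda = -2\sqrt{2}$, and for $\tau\in\mathbb{R}$ consider the percolation $$S_\tau = \{ v \in V(T_3) : X_v \leq \tau \}.$$ If $\tau \leq 0.086$, then each cluster of $S_\tau$ is finite almost surely. (For $\tau = 0.086$ the density of the percolation, i.e. $P(X_v \le \tau)$, is above $0.534$.)
   Context: A Gaussian process on $T_3$ is a collection of jointly Gaussian centered random variables $X_v$, $v \in V(T_3)$; it is invariant if its joint distribution is unchanged under every graph automorphism of $T_3$. For $|\lambda|\le 3$, the Gaussian wave function with eigenvalue $\lambda$ on $T_3$ is the invariant Gaussian process $(X_v)_{v\in V(T_3)}$, which exists and is unique in distribution, such that $\mathrm{var}(X_v)=1$ for all $v$ and, with probability $1$, $\sum_{u\in N(v)} X_u = \lambda X_v$ for every vertex $v$, where $N(v)$ is the set of neighbors of $v$. The clusters of $S_\tau$ are the connected components of the subgraph of $T_3$ induced on $S_\tau$. *)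

theory Defs
  imports "HOL-Probability.Probability"
begin

text \<open>Simple graphs are given by an adjacency relation whose vertex set is the whole vertex type.\<close>

type_synonym 'v graph = "'v \<Rightarrow> 'v \<Rightarrow> bool"

definition neighbors :: "'v graph \<Rightarrow> 'v \<Rightarrow> 'v set" where
  "neighbors adj v = {u. adj v u}"

definition simple_graph :: "'v graph \<Rightarrow> bool" where
  "simple_graph adj \<longleftrightarrow> symp adj \<and> irreflp adj"

definition connected_graph :: "'v graph \<Rightarrow> bool" where
  "connected_graph adj \<longleftrightarrow> (\<forall>u v. adj\<^sup>*\<^sup>* u v)"

definition graph_cycle :: "'v graph \<Rightarrow> 'v list \<Rightarrow> bool" where
  "graph_cycle adj xs \<longleftrightarrow>
     length xs \<ge> 3 \<and> distinct xs \<and> successively adj xs \<and> adj (last xs) (hd xs)"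

definition tree :: "'v graph \<Rightarrow> bool" where
  "tree adj \<longleftrightarrow> simple_graph adj \<and> connected_graph adj \<and> (\<nexists>xs. graph_cycle adj xs)"

text \<open>Since \<open>card\<close> of an infinite set is 0, a regular graph of positive degree is locally finite.\<close>

definition regular_graph :: "nat \<Rightarrow> 'v graph \<Rightarrow> bool" where
  "regular_graph d adj \<longleftrightarrow> (\<forall>v. card (neighbors adj v) = d)"

text \<open>The infinite 3-regular tree is determined up to isomorphism by being a 3-regular tree;
  infinitude is automatic, because a finite tree has a vertex of degree at most 1.\<close>

definition three_regular_tree :: "'v graph \<Rightarrow> bool" where
  "three_regular_tree adj \<longleftrightarrow> tree adj \<and> regular_graph 3 adj"

definition graph_automorphism :: "'v graph \<Rightarrow> ('v \<Rightarrow> 'v) \<Rightarrow> bool" where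
  "graph_automorphism adj \<phi> \<longleftrightarrow> bij \<phi> \<and> (\<forall>u v. adj (\<phi> u) (\<phi> v) \<longleftrightarrow> adj u v)"

definition induced_adj :: "'v graph \<Rightarrow> 'v set \<Rightarrow> 'v graph" where
  "induced_adj adj S = (\<lambda>u v. u \<in> S \<and> v \<in> S \<and> adj u v)"

definition clusters :: "'v graph \<Rightarrow> 'v set \<Rightarrow> 'v set set" where
  "clusters adj S = {{u. (induced_adj adj S)\<^sup>*\<^sup>* v u} | v. v \<in> S}"

text \<open>The point mass at 0 counts as a centered Gaussian (variance 0). This case is needed below:
  the eigenvector equation forces some linear combinations of the process to vanish.\<close>

definition centered_gaussian :: "'a measure \<Rightarrow> ('a \<Rightarrow> real) \<Rightarrow> bool" where
  "centered_gaussian M Y \<longleftrightarrow> Y \<in> borel_measurable M \<and>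
     ((AE \<omega> in M. Y \<omega> = 0) \<or> (\<exists>\<sigma>>0. distributed M lborel Y (normal_density 0 \<sigma>)))"

text \<open>Joint Gaussianity: every finite linear combination is Gaussian.\<close>

definition gaussian_process :: "'a measure \<Rightarrow> ('v \<Rightarrow> 'a \<Rightarrow> real) \<Rightarrow> bool" where
  "gaussian_process M X \<longleftrightarrow>
     (\<forall>F c. finite F \<longrightarrow> centered_gaussian M (\<lambda>\<omega>. \<Sum>v\<in>F. c v * X v \<omega>))"

definition process_law :: "'a measure \<Rightarrow> ('v \<Rightarrow> 'a \<Rightarrow> real) \<Rightarrow> ('v \<Rightarrow> real) measure" where
  "process_law M X = distr M (\<Pi>\<^sub>M v\<in>UNIV. borel) (\<lambda>\<omega> v. X v \<omega>)"

definition invariant_process :: "'a measure \<Rightarrow> 'v graph \<Rightarrow> ('v \<Rightarrow> 'a \<Rightarrow> real) \<Rightarrow> bool" where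
  "invariant_process M adj X \<longleftrightarrow>
     (\<forall>\<phi>. graph_automorphism adj \<phi> \<longrightarrow> process_law M (\<lambda>v. X (\<phi> v)) = process_law M X)"

definition (in prob_space) gaussian_wave_function ::
  "'v graph \<Rightarrow> real \<Rightarrow> ('v \<Rightarrow> 'a \<Rightarrow> real) \<Rightarrow> bool" where
  "gaussian_wave_function adj l X \<longleftrightarrow>
     gaussian_process M X \<and> invariant_process M adj X \<and>
     (\<forall>v. variance (X v) = 1) \<and>
     (AE \<omega> in M. \<forall>v. (\<Sum>u\<in>neighbors adj v. X u \<omega>) = l * X v \<omega>)"

definition percolation :: "('v \<Rightarrow> 'a \<Rightarrow> real) \<Rightarrow> real \<Rightarrow> 'a \<Rightarrow> 'v set" where
  "percolation X \<tau> \<omega> = {v. X v \<omega> \<le> \<tau>}"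

end

theory Submission
  imports Defs
begin

text \<open>
  Along a non-backtracking path \<open>\<dots>, x, y, w\<close> the eigenvector equation reads
  \<open>X\<^sub>w = - sqrt 2 * X\<^sub>y - X\<^sub>x / 2 + e\<close> with \<open>e = (X\<^sub>w - X\<^sub>w\<^sub>') / 2\<close>, where \<open>w'\<close> is the third neighbour
  of \<open>y\<close>. The automorphism exchanging the branches at \<open>w\<close> and \<open>w'\<close> shows that \<open>e\<close> is orthogonal
  to, hence independent of, the older part of the path, and \<open>e\<close> has variance \<open>1/12\<close>. Bounding the
  density of \<open>e\<close> by a constant multiple of \<open>exp (2 * e)\<close> makes the expectation of
  \<open>exp (X\<^sub>y + (1 + 2 * sqrt 2) * X\<^sub>w)\<close> over the event that the path lies below \<open>0.086\<close> shrink by a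
  factor of about \<open>0.463\<close> with every new vertex. There are at most \<open>3 * 2 ^ n\<close> paths of length \<open>n\<close>
  from a given vertex, so, the factor being less than \<open>1/2\<close>, almost surely the paths from this
  vertex that stay below the threshold have bounded length.
\<close>

section \<open>Non-backtracking walks in the cubic tree\<close>

fun nb_walk :: "'v graph \<Rightarrow> 'v list \<Rightarrow> bool" where
  "nb_walk adj [] \<longleftrightarrow> True"
| "nb_walk adj [a] \<longleftrightarrow> True"
| "nb_walk adj [a, b] \<longleftrightarrow> adj a b"
| "nb_walk adj (a # b # c # xs) \<longleftrightarrow> adj a b \<and> a \<noteq> c \<and> nb_walk adj (b # c # xs)"

lemma nb_walk_Cons_Cons:
  "nb_walk adj (a # b # xs) \<longleftrightarrow> adj a b \<and> (xs \<noteq> [] \<longrightarrow> a \<noteq> hd xs) \<and> nb_walk adj (b # xs)"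
  by (cases xs) auto

lemma nb_walk_tl: "nb_walk adj (a # xs) \<Longrightarrow> nb_walk adj xs"
  by (cases xs) (auto simp: nb_walk_Cons_Cons)

lemma nb_walk_suffix: "nb_walk adj (us @ vs) \<Longrightarrow> nb_walk adj vs"
  by (induction us) (auto dest: nb_walk_tl)

lemma nb_walk_prefix: "nb_walk adj (us @ vs) \<Longrightarrow> nb_walk adj us"
proof (induction us)
  case (Cons a us)
  then show ?case
    by (cases us) (auto simp: nb_walk_Cons_Cons)
qed simp

lemma nb_walk_glue:
  assumes "nb_walk adj (us @ [a])" "nb_walk adj (a # vs)"
    and "us \<noteq> [] \<Longrightarrow> vs \<noteq> [] \<Longrightarrow> last us \<noteq> hd vs"
  shows "nb_walk adj (us @ a # vs)"
  using assms
proof (induction us)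
  case (Cons b us)
  then show ?case
    by (cases us) (auto simp: nb_walk_Cons_Cons hd_append)
qed simp

lemma nb_walk_successively: "nb_walk adj xs \<Longrightarrow> successively adj xs"
  by (induction adj xs rule: nb_walk.induct) auto

locale cubic_tree =
  fixes adj :: "'v graph"
  assumes cubic: "three_regular_tree adj"
begin

lemma adj_sym: "adj u v \<Longrightarrow> adj v u"
  using cubic unfolding three_regular_tree_def tree_def simple_graph_def by (auto dest: sympD)

lemma adj_irrefl: "\<not> adj u u"
  using cubic unfolding three_regular_tree_def tree_def simple_graph_def by (auto dest: irreflpD)

lemma connected: "adj\<^sup>*\<^sup>* u v"
  using cubic unfolding three_regular_tree_def tree_def connected_graph_def by auto

lemma acyclic: "\<not> graph_cycle adj xs"
  using cubic unfolding three_regular_tree_def tree_def by auto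

lemma card_neighbors: "card (neighbors adj v) = 3"
  using cubic unfolding three_regular_tree_def regular_graph_def by auto

lemma finite_neighbors: "finite (neighbors adj v)"
  using card_neighbors[of v] by (intro card_ge_0_finite) simp

lemma nb_walk_rev: "nb_walk adj xs \<Longrightarrow> nb_walk adj (rev xs)"
proof (induction xs)
  case (Cons a xs)
  show ?case
  proof (cases xs)
    case (Cons b ys)
    have "nb_walk adj (rev ys @ b # [a])"
    proof (rule nb_walk_glue)
      show "nb_walk adj (rev ys @ [b])" "nb_walk adj [b, a]"
        using Cons.IH Cons.prems Cons by (auto simp: nb_walk_Cons_Cons intro: adj_sym)
      show "last (rev ys) \<noteq> hd [a]" if "rev ys \<noteq> []"
        using that Cons.prems Cons by (auto simp: nb_walk_Cons_Cons last_rev)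
    qed
    then show ?thesis using Cons by simp
  qed simp
qed simp

text \<open>A recurrence of the head would close a cycle, because the vertices after the head are
  distinct by induction.\<close>

lemma nb_walk_distinct: "nb_walk adj xs \<Longrightarrow> distinct xs"
proof (induction xs)
  case (Cons a xs)
  have dist: "distinct xs" using Cons by (auto dest: nb_walk_tl)
  have "a \<notin> set xs"
  proof
    assume "a \<in> set xs"
    then obtain us vs where xs: "xs = us @ a # vs" by (auto dest: split_list)
    have w: "nb_walk adj (a # us @ [a])"
      using Cons.prems nb_walk_prefix[of adj "a # us @ [a]" vs] by (simp add: xs)
    \<comment> \<open>No inner vertex would give a loop at \<open>a\<close>, a single one a
      backtracking step, so the closed piece has the three vertices that a cycle requires.\<close>
    have us: "length us \<ge> 2"
      using w adj_irrefl by (cases us rule: remdups_adj.cases) auto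
    have "successively adj ((a # us) @ [a])" using nb_walk_successively[OF w] by simp
    then have "successively adj (a # us)" "adj (last (a # us)) a"
      unfolding successively_append_iff by auto
    then have "graph_cycle adj (a # us)"
      using us dist unfolding graph_cycle_def xs by auto
    then show False using acyclic by blast
  qed
  then show ?case using dist by simp
qed simp

text \<open>If the walks part at their common head, one of them reversed and glued to the other is
  again non-backtracking. Its vertices would be distinct, although both halves contain the common
  last vertex.\<close>

lemma nb_walk_unique:
  "nb_walk adj xs \<Longrightarrow> nb_walk adj ys \<Longrightarrow> xs \<noteq> [] \<Longrightarrow> ys \<noteq> [] \<Longrightarrow> hd xs = hd ys \<Longrightarrow>
    last xs = last ys \<Longrightarrow> xs = ys"
proof (induction xs arbitrary: ys)
  case (Cons a xs zs)
  obtain ys where zs: "zs = a # ys" using Cons.prems by (cases zs) auto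
  have d: "distinct (a # xs)" "distinct (a # ys)"
    using Cons.prems nb_walk_distinct zs by blast+
  show ?case
  proof (cases "xs = [] \<or> ys = []")
    case True
    then have "xs = [] \<and> ys = []"
      using d Cons.prems(6) unfolding zs by (auto split: if_splits)
    then show ?thesis using zs by simp
  next
    case False
    show ?thesis
    proof (cases "hd xs = hd ys")
      case True
      then have "xs = ys"
        using Cons.prems False unfolding zs by (intro Cons.IH) (auto dest: nb_walk_tl)
      then show ?thesis using zs by simp
    next
      case ne: False
      have "nb_walk adj (rev xs @ a # ys)"
      proof (rule nb_walk_glue)
        show "nb_walk adj (rev xs @ [a])" using nb_walk_rev[OF Cons.prems(1)] by simp
        show "nb_walk adj (a # ys)" using Cons.prems(2) zs by simp
        show "last (rev xs) \<noteq> hd ys" using ne False by (simp add: last_rev)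
      qed
      from nb_walk_distinct[OF this] have "set xs \<inter> set ys = {}" by auto
      moreover have "last xs = last ys" using Cons.prems(6) False unfolding zs by simp
      ultimately show ?thesis using False last_in_set[of xs] last_in_set[of ys] by auto
    qed
  qed
qed simp

subsection \<open>Exchanging two branches\<close>

text \<open>An arbitrary labelling of the two neighbors of \<open>v\<close> other than
  \<open>u\<close> by truth values, so that the vertices of a branch receive binary words as
  addresses.\<close>

definition child :: "'v \<Rightarrow> 'v \<Rightarrow> bool \<Rightarrow> 'v" where
  "child u v = (SOME f. neighbors adj v - {u} = {f True, f False} \<and> f True \<noteq> f False)"

lemma child:
  assumes "adj u v"
  shows "neighbors adj v - {u} = {child u v True, child u v False}"
    and "child u v True \<noteq> child u v False"
proof -
  have "u \<in> neighbors adj v" using adj_sym[OF assms] by (simp add: neighbors_def)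
  then have "card (neighbors adj v - {u}) = 2"
    using card_neighbors[of v] by simp
  then obtain a b where "neighbors adj v - {u} = {a, b}" "a \<noteq> b"
    by (auto simp: card_2_iff)
  then have "\<exists>f. neighbors adj v - {u} = {f True, f False} \<and> f True \<noteq> f False"
    by (intro exI[of _ "\<lambda>x. if x then a else b"]) auto
  from someI_ex[OF this]
  show "neighbors adj v - {u} = {child u v True, child u v False}"
    and "child u v True \<noteq> child u v False"
    unfolding child_def by auto
qed

text \<open>The newest turn is at the head of the word. The whole walk back to \<open>p\<close> is
  kept because the next child depends on two vertices, and because addresses are unique by the
  uniqueness of walks.\<close>

primrec bwalk :: "'v \<Rightarrow> 'v \<Rightarrow> bool list \<Rightarrow> 'v list" where
  "bwalk p w [] = [w, p]"
| "bwalk p w (b # l) = child (hd (tl (bwalk p w l))) (hd (bwalk p w l)) b # bwalk p w l"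

definition node :: "'v \<Rightarrow> 'v \<Rightarrow> bool list \<Rightarrow> 'v" where
  "node p w l = hd (bwalk p w l)"

definition parent :: "'v \<Rightarrow> 'v \<Rightarrow> bool list \<Rightarrow> 'v" where
  "parent p w l = (if l = [] then p else node p w (tl l))"

lemma bwalk_eq: "bwalk p w l = node p w l # parent p w l # tl (tl (bwalk p w l))"
  by (cases l; cases "tl l") (auto simp: node_def parent_def)

lemma bwalk_end: "\<exists>zs. bwalk p w l = zs @ [w, p]"
  by (induction l) auto

lemma length_bwalk: "length (bwalk p w l) = length l + 2"
  by (induction l) auto

lemma node_Cons: "node p w (b # l) = child (parent p w l) (node p w l) b"
  by (subst node_def) (subst bwalk.simps, subst (1 2) bwalk_eq, simp)

lemma bwalk_Cons: "bwalk p w (b # l) = node p w (b # l) # bwalk p w l"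
  by (simp add: node_def)

lemma nb_bwalk:
  assumes "adj p w"
  shows "nb_walk adj (bwalk p w l)"
proof (induction l)
  case Nil
  then show ?case using adj_sym[OF assms] by simp
next
  case (Cons b l)
  have "nb_walk adj (node p w l # parent p w l # tl (tl (bwalk p w l)))"
    using Cons by (subst (asm) bwalk_eq)
  then have "adj (parent p w l) (node p w l)"
    by (auto simp: nb_walk_Cons_Cons intro: adj_sym)
  then have "node p w (b # l) \<in> neighbors adj (node p w l) - {parent p w l}"
    using child(1)[of "parent p w l" "node p w l"] unfolding node_Cons by (cases b) auto
  then have "adj (node p w (b # l)) (node p w l)" "node p w (b # l) \<noteq> parent p w l"
    by (auto simp: neighbors_def intro: adj_sym)
  then show ?case
    using Cons unfolding bwalk_Cons by (subst bwalk_eq, subst (asm) bwalk_eq) simp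
qed

lemma adj_parent: "adj p w \<Longrightarrow> adj (parent p w l) (node p w l)"
  using nb_bwalk[of p w l] by (subst (asm) bwalk_eq) (auto simp: nb_walk_Cons_Cons intro: adj_sym)

lemma adj_node_iff:
  assumes "adj p w"
  shows "adj (node p w l) v \<longleftrightarrow> v = parent p w l \<or> (\<exists>b. v = node p w (b # l))"
proof -
  have "adj (node p w l) v \<longleftrightarrow> v \<in> neighbors adj (node p w l)" by (simp add: neighbors_def)
  also have "\<dots> \<longleftrightarrow> v = parent p w l \<or> v \<in> neighbors adj (node p w l) - {parent p w l}"
    using adj_sym[OF adj_parent[OF assms, of l]] by (auto simp: neighbors_def)
  also have "\<dots> \<longleftrightarrow> v = parent p w l \<or> (\<exists>b. v = node p w (b # l))"
    unfolding child(1)[OF adj_parent[OF assms]] node_Cons by (simp add: ex_bool_eq)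
  finally show ?thesis .
qed

lemma bwalk_inj:
  assumes "adj p w" "bwalk p w l = bwalk p w' l'"
  shows "w = w' \<and> l = l'"
proof -
  have "length l = length l'" using assms(2) length_bwalk by (metis add_right_cancel)
  then show ?thesis using assms(2)
  proof (induction l l' rule: list_induct2)
    case (Cons b l b' l')
    then have eq: "node p w (b # l) = node p w' (b' # l')" "bwalk p w l = bwalk p w' l'"
      unfolding bwalk_Cons by auto
    with Cons have "w = w'" "l = l'" by auto
    moreover have "b = b'"
      using eq(1) child(2)[OF adj_parent[OF assms(1), of l]]
      unfolding \<open>w = w'\<close>[symmetric] \<open>l = l'\<close>[symmetric] node_Cons by (cases b; cases b') auto
    ultimately show ?case by simp
  qed auto
qed

text \<open>Two addresses of one vertex give two non-backtracking walks from it to \<open>p\<close>.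
  These coincide, and the walk determines both its branch and its word.\<close>

lemma node_eq_imp:
  assumes "adj p w" "adj p w'" "node p w l = node p w' l'"
  shows "w = w'" "l = l'"
proof -
  have "last (bwalk p w l) = last (bwalk p w' l')"
    using bwalk_end[of p w l] bwalk_end[of p w' l'] by auto
  moreover have "bwalk p w l \<noteq> []" "bwalk p w' l' \<noteq> []"
    by (subst bwalk_eq; simp)+
  ultimately have "bwalk p w l = bwalk p w' l'"
    using assms by (intro nb_walk_unique nb_bwalk) (auto simp: node_def)
  from bwalk_inj[OF assms(1) this] show "w = w'" "l = l'" by auto
qed

text \<open>The first step away from \<open>p\<close> of a walk to a vertex in the branch at \<open>w\<close> leads to \<open>w\<close>.\<close>

lemma node_notin_walk:
  assumes "adj p w" "nb_walk adj (p # xs)" "xs \<noteq> [] \<Longrightarrow> hd xs \<noteq> w"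
  shows "node p w l \<notin> set (p # xs)"
proof
  obtain zs where zs: "bwalk p w l = zs @ [w, p]" using bwalk_end by blast
  have ne: "node p w l \<noteq> p"
    using nb_walk_distinct[OF nb_bwalk[OF assms(1), of l]] zs
    by (cases zs) (auto simp: node_def)
  assume "node p w l \<in> set (p # xs)"
  with ne have "node p w l \<in> set xs" by simp
  then obtain us vs where xs: "xs = us @ node p w l # vs" by (auto dest: split_list)
  have "nb_walk adj (p # us @ [node p w l])"
    using assms(2) nb_walk_prefix[of adj "p # us @ [node p w l]" vs] by (simp add: xs)
  then have "rev (p # us @ [node p w l]) = bwalk p w l"
    by (intro nb_walk_unique nb_walk_rev nb_bwalk assms) (auto simp: zs, simp add: node_def zs[symmetric])
  then have "p # us @ [node p w l] = p # w # rev zs"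
    using zs by (metis rev_append rev_rev_ident rev.simps append_Cons append_Nil)
  then show False using assms(3) xs by (cases us) auto
qed

text \<open>The reflection at \<open>p\<close> that matches equal addresses in the branches at
  \<open>w\<close> and \<open>w'\<close>. Each \<open>inv\<close> is applied only on the range of
  its address map.\<close>

definition swap_branches :: "'v \<Rightarrow> 'v \<Rightarrow> 'v \<Rightarrow> 'v \<Rightarrow> 'v" where
  "swap_branches p w w' v =
     (if v \<in> range (node p w) then node p w' (inv (node p w) v)
      else if v \<in> range (node p w') then node p w (inv (node p w') v) else v)"

context
  fixes p w w' :: 'v
  assumes pw: "adj p w" and pw': "adj p w'" and ww': "w \<noteq> w'"
begin

lemma inj_node: "inj (node p w)" "inj (node p w')"
  using node_eq_imp pw pw' by (auto intro!: injI)

lemma swap_node: "swap_branches p w w' (node p w l) = node p w' l"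
  "swap_branches p w w' (node p w' l) = node p w l"
  using node_eq_imp(1)[OF pw pw', of l] node_eq_imp(1)[OF pw' pw, of l] ww' inj_node by (auto simp: swap_branches_def)

text \<open>A walk that leaves \<open>p\<close> towards neither branch never enters one. Applied to
  the older part of a path, this makes the reflection act trivially there.\<close>

lemma swap_fixed:
  assumes "nb_walk adj (p # xs)" "xs \<noteq> [] \<Longrightarrow> hd xs \<noteq> w \<and> hd xs \<noteq> w'" "x \<in> set (p # xs)"
  shows "swap_branches p w w' x = x"
proof -
  have "node p w l \<noteq> x" "node p w' l \<noteq> x" for l
    using node_notin_walk[OF pw assms(1)] node_notin_walk[OF pw' assms(1)] assms(2,3) by blast+
  then show ?thesis unfolding swap_branches_def by (auto simp: image_iff)
qed

lemma swap_p: "swap_branches p w w' p = p"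
  by (rule swap_fixed[of "[]"]) auto

lemma swap_parent:
  "swap_branches p w w' (parent p w l) = parent p w' l"
  "swap_branches p w w' (parent p w' l) = parent p w l"
  by (auto simp: parent_def swap_node swap_p)

lemma swap_invol: "swap_branches p w w' (swap_branches p w w' v) = v"
proof (cases "v \<in> range (node p w) \<union> range (node p w')")
  case True
  then show ?thesis by (auto simp: swap_node)
next
  case False
  then have "swap_branches p w w' v = v" by (auto simp: swap_branches_def)
  then show ?thesis by simp
qed

lemma swap_adj:
  assumes "adj u v"
  shows "adj (swap_branches p w w' u) (swap_branches p w w' v)"
proof -
  \<comment> \<open>The neighbors of an address are its parent and its two extensions, and the swap
    respects both. The parent of the empty address is \<open>p\<close>, which stays fixed.\<close>
  have in_branch: "adj (swap_branches p w w' u) (swap_branches p w w' v)"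
    if "adj u v" "u \<in> range (node p w) \<union> range (node p w')" for u v
    using that adj_node_iff[OF pw] adj_node_iff[OF pw'] swap_node swap_parent by (auto 0 4)
  consider "u \<in> range (node p w) \<union> range (node p w')" | "v \<in> range (node p w) \<union> range (node p w')"
    | "u \<notin> range (node p w) \<union> range (node p w')" "v \<notin> range (node p w) \<union> range (node p w')"
    by blast
  then show ?thesis
  proof cases
    case 1
    then show ?thesis using in_branch assms by blast
  next
    case 2
    then show ?thesis using in_branch[of v u] assms adj_sym by blast
  next
    case 3
    then show ?thesis using assms by (simp add: swap_branches_def)
  qed
qed

lemma swap_automorphism: "graph_automorphism adj (swap_branches p w w')"
  unfolding graph_automorphism_def
proof (intro conjI allI)
  show "bij (swap_branches p w w')"
    by (rule involuntory_imp_bij) (rule swap_invol)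
  show "adj (swap_branches p w w' u) (swap_branches p w w' v) = adj u v" for u v
    using swap_adj[of u v] swap_adj[of "swap_branches p w w' u" "swap_branches p w w' v"]
    by (auto simp: swap_invol)
qed

end

subsection \<open>Counting walks\<close>

text \<open>Walks grow at the head: the base vertex \<open>v\<close> comes last, the newest vertex
  first, and \<open>n\<close> counts edges.\<close>

definition walks :: "'v \<Rightarrow> nat \<Rightarrow> 'v list set" where
  "walks v n = {xs. nb_walk adj xs \<and> length xs = Suc n \<and> last xs = v}"

lemma walks_0: "walks v 0 = {[v]}"
  by (auto simp: walks_def length_Suc_conv)

text \<open>\<open>set (take 1 (tl xs))\<close> holds the vertex before the newest one, to which the
  extension must not return. It is empty for a one-vertex walk, where all neighbors are
  allowed.\<close>

lemma walks_Suc: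
  "walks v (Suc n) \<subseteq> (\<Union>xs \<in> walks v n. (\<lambda>a. a # xs) ` (neighbors adj (hd xs) - set (take 1 (tl xs))))"
proof
  fix xs assume "xs \<in> walks v (Suc n)"
  then obtain a b ys where xs: "xs = a # b # ys"
    and "nb_walk adj (a # b # ys)" "length ys = n" "last (b # ys) = v"
    by (auto simp: walks_def length_Suc_conv)
  then have "b # ys \<in> walks v n" "a \<in> neighbors adj b - set (take 1 ys)"
    by (auto simp: walks_def nb_walk_Cons_Cons neighbors_def intro: adj_sym) (cases ys; auto)
  then show "xs \<in> (\<Union>xs \<in> walks v n. (\<lambda>a. a # xs) ` (neighbors adj (hd xs) - set (take 1 (tl xs))))"
    using xs by (intro UN_I[of "b # ys"]) auto
qed

lemma finite_walks: "finite (walks v n)"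
proof (induction n)
  case (Suc n)
  then show ?case using finite_neighbors by (intro finite_subset[OF walks_Suc]) auto
qed (simp add: walks_0)

text \<open>The first step has three choices and each later one two. The slack of a factor 2 for
  positive \<open>n\<close> lets one formula cover \<open>n = 0\<close> as well.\<close>

lemma card_walks: "card (walks v n) \<le> 3 * 2 ^ n"
proof (induction n rule: nat_induct)
  case (Suc n)
  let ?ext = "\<lambda>xs. (\<lambda>a. a # xs) ` (neighbors adj (hd xs) - set (take 1 (tl xs)))"
  have le: "card (walks v (Suc n)) \<le> (\<Sum>xs\<in>walks v n. card (?ext xs))"
    by (rule order_trans[OF card_mono[OF _ walks_Suc] card_UN_le])
       (auto simp: finite_walks finite_neighbors)
  show ?case
  proof (cases n)
    case 0
    have "card (?ext [v]) \<le> 3"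
      using card_image_le[OF finite_neighbors, of "\<lambda>a. [a, v]" v] card_neighbors by simp
    then show ?thesis using le 0 by (simp add: walks_0)
  next
    case (Suc m)
    have "card (?ext xs) \<le> 2" if xs: "xs \<in> walks v n" for xs
    proof -
      obtain a b ys where eq: "xs = a # b # ys"
        using xs unfolding walks_def Suc by (auto simp: length_Suc_conv)
      have "b \<in> neighbors adj a"
        using xs unfolding eq walks_def by (auto simp: nb_walk_Cons_Cons neighbors_def)
      then have "card (neighbors adj a - {b}) = 2" using card_neighbors[of a] by simp
      moreover have "card (?ext xs) \<le> card (neighbors adj a - {b})"
        unfolding eq using finite_neighbors by (simp add: card_image_le)
      ultimately show ?thesis by linarith
    qed
    then have "(\<Sum>xs\<in>walks v n. card (?ext xs)) \<le> (\<Sum>xs\<in>walks v n. 2)" by (intro sum_mono) auto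
    also have "\<dots> \<le> 3 * 2 ^ Suc n" using Suc.IH by simp
    finally show ?thesis using le by linarith
  qed
qed (simp add: walks_0)

section \<open>Long walks in infinite clusters\<close>

lemma walk_to_reachable:
  assumes "(induced_adj adj S)\<^sup>*\<^sup>* v u" "v \<in> S"
  shows "\<exists>n. \<exists>xs\<in>walks v n. hd xs = u \<and> set xs \<subseteq> S"
  using assms
proof (induction rule: rtranclp_induct)
  case base
  then show ?case by (intro exI[of _ 0]) (auto simp: walks_0)
next
  case (step y z)
  then obtain n xs where xs: "xs \<in> walks v n" "hd xs = y" "set xs \<subseteq> S" by auto
  obtain ys where ys: "xs = y # ys" using xs by (cases xs) (auto simp: walks_def)
  have yz: "adj z y" "z \<in> S" using step(2) adj_sym by (auto simp: induced_adj_def)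
  show ?case
  \<comment> \<open>A path in the cluster may turn back. In that case the walk loses its newest
    vertex; otherwise it gains \<open>z\<close>.\<close>
  proof (cases "ys \<noteq> [] \<and> hd ys = z")
    case True
    then have "ys \<in> walks v (n - 1)" using xs nb_walk_tl unfolding ys walks_def by auto
    then show ?thesis using True xs ys by auto
  next
    case False
    then have "z # xs \<in> walks v (Suc n)"
      using xs yz unfolding ys walks_def by (auto simp: nb_walk_Cons_Cons)
    then show ?thesis using xs yz by (intro exI[of _ "Suc n"] bexI[of _ "z # xs"]) auto
  qed
qed

text \<open>If length \<open>n\<close> did not occur in \<open>S\<close>, every vertex of the
  cluster would be the head of one of the finitely many shorter walks.\<close>

lemma long_walk_in_infinite_cluster:
  assumes "v \<in> S" "infinite {u. (induced_adj adj S)\<^sup>*\<^sup>* v u}"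
  shows "\<exists>xs\<in>walks v n. set xs \<subseteq> S"
proof (rule ccontr)
  assume no: "\<not> ?thesis"
  have "{u. (induced_adj adj S)\<^sup>*\<^sup>* v u} \<subseteq> hd ` (\<Union>m\<in>{..<n}. walks v m)"
  proof
    fix u assume "u \<in> {u. (induced_adj adj S)\<^sup>*\<^sup>* v u}"
    then obtain m xs where xs: "xs \<in> walks v m" "hd xs = u" "set xs \<subseteq> S"
      using walk_to_reachable assms(1) by blast
    have "m < n"
    proof (rule ccontr)
      assume "\<not> m < n"
      \<comment> \<open>The last \<open>n + 1\<close> vertices of a longer walk form a walk with
        \<open>n\<close> edges that still ends in \<open>v\<close>.\<close>
      define ys where "ys = drop (m - n) xs"
      have "nb_walk adj (take (m - n) xs @ ys)" using xs by (simp add: walks_def ys_def)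
      from nb_walk_suffix[OF this] have "ys \<in> walks v n"
        using xs \<open>\<not> m < n\<close> unfolding walks_def ys_def by (auto simp: last_drop)
      moreover have "set ys \<subseteq> S" using xs(3) set_drop_subset unfolding ys_def by fast
      ultimately show False using no by blast
    qed
    then show "u \<in> hd ` (\<Union>m\<in>{..<n}. walks v m)" using xs by blast
  qed
  then have "finite {u. (induced_adj adj S)\<^sup>*\<^sup>* v u}"
    by (rule finite_subset) (auto intro: finite_walks)
  then show False using assms(2) by blast
qed

lemma countable_vertices: "countable (UNIV :: 'v set)"
proof -
  fix v :: 'v
  have "UNIV \<subseteq> hd ` (\<Union>n. walks v n)"
  proof
    fix u
    have "induced_adj adj UNIV = adj" by (simp add: induced_adj_def)
    then show "u \<in> hd ` (\<Union>n. walks v n)"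
      using walk_to_reachable[of UNIV v u] connected by force
  qed
  then show ?thesis
    by (rule countable_subset) (auto intro: countable_finite finite_walks)
qed

end

section \<open>Independence of Gaussian variables\<close>

text \<open>For large \<open>D\<close> the function \<open>1 + W / D\<close> is a probability
  density. Under this change of measure \<open>Y\<close> keeps its characteristic function, hence
  its law by Levy uniqueness, so \<open>W\<close> integrates to zero over every event
  \<open>Y \<in> B\<close>.\<close>

lemma (in prob_space) signed_weight_orthogonal:
  fixes W Y :: "'a \<Rightarrow> real"
  assumes [measurable]: "W \<in> borel_measurable M" "Y \<in> borel_measurable M"
    and bound: "\<And>\<omega>. \<bar>W \<omega>\<bar> \<le> C"
    and cos0: "\<And>t. expectation (\<lambda>\<omega>. W \<omega> * cos (t * Y \<omega>)) = 0"
    and sin0: "\<And>t. expectation (\<lambda>\<omega>. W \<omega> * sin (t * Y \<omega>)) = 0"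
    and [measurable]: "B \<in> sets borel"
  shows "expectation (\<lambda>\<omega>. W \<omega> * indicator B (Y \<omega>)) = 0"
proof -
  \<comment> \<open>The bound forces \<open>C \<ge> 0\<close>; adding 1 makes \<open>D\<close>
    positive even for \<open>C = 0\<close>.\<close>
  define D where "D = C + 1"
  have D: "D > 0" using bound[of undefined] by (simp add: D_def)
  have bd: "\<bar>W \<omega>\<bar> \<le> D" for \<omega> using bound[of \<omega>] by (simp add: D_def)
  define w where "w \<omega> = 1 + W \<omega> / D" for \<omega>
  have [measurable]: "w \<in> borel_measurable M" unfolding w_def by measurable
  have w0: "0 \<le> w \<omega>" for \<omega> using bd[of \<omega>] D by (auto simp: w_def field_simps abs_le_iff)
  have intW: "integrable M W"
    using bound by (intro integrable_const_bound[of _ C]) auto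
  \<comment> \<open>The case \<open>t = 0\<close> of the cosine hypothesis says that
    \<open>W\<close> has mean zero.\<close>
  have Ew: "expectation w = 1"
    using cos0[of 0] intW unfolding w_def by (simp add: prob_space)
  define N where "N = density M (\<lambda>\<omega>. ennreal (w \<omega>))"
  have [simp, measurable_cong]: "sets N = sets M" by (simp add: N_def)
  have N: "prob_space N"
  proof
    have "emeasure N (space N) = (\<integral>\<^sup>+\<omega>. ennreal (w \<omega>) \<partial>M)"
      by (simp add: N_def emeasure_density cong: nn_integral_cong)
    also have "\<dots> = ennreal (expectation w)"
      using intW w0 by (intro nn_integral_eq_integral) (auto simp: w_def)
    finally show "emeasure N (space N) = 1" by (simp add: Ew)
  qed
  have YN[measurable]: "Y \<in> borel_measurable N" unfolding N_def by simp
  have rd: "real_distribution (distr N borel Y)" "real_distribution (distr M borel Y)"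
    by (auto simp: real_distribution_def real_distribution_axioms_def intro!: prob_space.prob_space_distr N prob_space_distr)
  have "char (distr N borel Y) t = char (distr M borel Y) t" for t
  proof -
    have i1: "integrable M (\<lambda>\<omega>. W \<omega> * cos (t * Y \<omega>))" "integrable M (\<lambda>\<omega>. W \<omega> * sin (t * Y \<omega>))"
      using order_trans[OF mult_left_le bound]
      by (auto intro!: integrable_const_bound[of _ C] AE_I2 simp: abs_mult)
    have z: "(CLINT \<omega>|M. W \<omega> *\<^sub>R iexp (t * Y \<omega>)) = 0"
    proof -
      have "(CLINT \<omega>|M. W \<omega> *\<^sub>R iexp (t * Y \<omega>))
          = (CLINT \<omega>|M. complex_of_real (W \<omega> * cos (t * Y \<omega>)) + \<i> * complex_of_real (W \<omega> * sin (t * Y \<omega>)))"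
        by (intro Bochner_Integration.integral_cong refl)
           (simp add: complex_eq_iff exp_Euler[symmetric] Re_exp Im_exp)
      also have "\<dots> = complex_of_real (expectation (\<lambda>\<omega>. W \<omega> * cos (t * Y \<omega>)))
          + \<i> * complex_of_real (expectation (\<lambda>\<omega>. W \<omega> * sin (t * Y \<omega>)))"
        using i1 by (subst Bochner_Integration.integral_add) (auto simp del: of_real_mult)
      finally show ?thesis by (simp add: cos0 sin0)
    qed
    have i2: "integrable M (\<lambda>\<omega>. W \<omega> *\<^sub>R iexp (t * Y \<omega>))"
      using bound by (auto intro!: integrable_const_bound[of _ C])
    have "char (distr N borel Y) t = (CLINT \<omega>|N. iexp (t * Y \<omega>))"
      unfolding char_def by (subst integral_distr) auto
    also have "\<dots> = (CLINT \<omega>|M. w \<omega> *\<^sub>R iexp (t * Y \<omega>))"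
      unfolding N_def by (subst integral_density) (auto simp: w0)
    also have "\<dots> = (CLINT \<omega>|M. iexp (t * Y \<omega>) + (W \<omega> *\<^sub>R iexp (t * Y \<omega>)) / D)"
      by (intro Bochner_Integration.integral_cong refl) (simp add: w_def scaleR_conv_of_real field_simps)
    also have "\<dots> = (CLINT \<omega>|M. iexp (t * Y \<omega>))"
      using i2 integrable_iexp[of "\<lambda>\<omega>. t * Y \<omega>"] z by (subst Bochner_Integration.integral_add) auto
    also have "\<dots> = char (distr M borel Y) t"
      unfolding char_def by (subst integral_distr) auto
    finally show ?thesis .
  qed
  then have eq: "distr N borel Y = distr M borel Y" by (intro Levy_uniqueness rd ext)
  have "expectation (\<lambda>\<omega>. w \<omega> * indicator B (Y \<omega>)) = (\<integral>\<omega>. indicator B (Y \<omega>) \<partial>N)"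
    unfolding N_def by (subst integral_density) (auto simp: w0)
  also have "\<dots> = (\<integral>x. indicator B x \<partial>distr N borel Y)" by (subst integral_distr) auto
  also have "\<dots> = expectation (\<lambda>\<omega>. indicator B (Y \<omega>))" unfolding eq by (subst integral_distr) auto
  finally have *: "expectation (\<lambda>\<omega>. w \<omega> * indicator B (Y \<omega>)) = expectation (\<lambda>\<omega>. indicator B (Y \<omega>))" .
  have i3: "integrable M (\<lambda>\<omega>. W \<omega> * indicator B (Y \<omega>))"
    using bound order_trans[OF abs_ge_zero bound]
    by (auto intro!: integrable_const_bound[of _ C] simp: abs_mult indicator_def)
  have i4: "integrable M (\<lambda>\<omega>. indicator B (Y \<omega>) :: real)"
    by (intro integrable_const_bound[of _ 1]) (auto simp: indicator_def)
  have "expectation (\<lambda>\<omega>. w \<omega> * indicator B (Y \<omega>))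
      = expectation (\<lambda>\<omega>. indicator B (Y \<omega>) + W \<omega> * indicator B (Y \<omega>) / D)"
    by (intro Bochner_Integration.integral_cong refl) (simp add: w_def field_simps)
  also have "\<dots> = expectation (\<lambda>\<omega>. indicator B (Y \<omega>)) + expectation (\<lambda>\<omega>. W \<omega> * indicator B (Y \<omega>)) / D"
    using i3 i4 by (subst Bochner_Integration.integral_add) auto
  finally show ?thesis using * D by simp
qed

text \<open>Because of the free phase \<open>\<theta>\<close>, the hypothesis covers sines as well as cosines.\<close>

lemma (in prob_space) distr_pair_if_cos_factorizes:
  fixes Y :: "'i \<Rightarrow> 'a \<Rightarrow> real" and e :: "'a \<Rightarrow> real" and f :: "real \<Rightarrow> real"
  assumes P: "finite P"
    and [measurable]: "\<And>i. Y i \<in> borel_measurable M" "e \<in> borel_measurable M"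
    and factor: "\<And>c r \<theta>. expectation (\<lambda>\<omega>. cos ((\<Sum>i\<in>P. c i * Y i \<omega>) + r * e \<omega> + \<theta>))
        = f r * expectation (\<lambda>\<omega>. cos ((\<Sum>i\<in>P. c i * Y i \<omega>) + \<theta>))"
  shows "distr M (PiM P (\<lambda>_. borel)) (\<lambda>\<omega>. \<lambda>i\<in>P. Y i \<omega>) \<Otimes>\<^sub>M distr M borel e
      = distr M (PiM P (\<lambda>_. borel) \<Otimes>\<^sub>M borel) (\<lambda>\<omega>. (\<lambda>i\<in>P. Y i \<omega>, e \<omega>))"
proof -
  define L where "L c \<omega> = (\<Sum>i\<in>P. c i * Y i \<omega>)" for c \<omega>
  have [measurable]: "L c \<in> borel_measurable M" for c unfolding L_def by measurable
  \<comment> \<open>A multiple of \<open>Y k\<close> is absorbed by changing one coefficient, which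
    is why the coefficients stay arbitrary in the induction below.\<close>
  have L_upd: "L (c(k := c k + t)) \<omega> = L c \<omega> + t * Y k \<omega>" if "k \<in> P" for c k t \<omega>
    unfolding L_def using P that by (simp add: sum.remove[of P k] algebra_simps)
  have [measurable]: "(\<lambda>\<omega>. \<lambda>i\<in>P. Y i \<omega>) \<in> measurable M (PiM P (\<lambda>_. borel))"
    by measurable
  have box: "prob {\<omega>\<in>space M. (\<forall>i\<in>P. Y i \<omega> \<in> B i) \<and> e \<omega> \<in> E}
      = prob {\<omega>\<in>space M. \<forall>i\<in>P. Y i \<omega> \<in> B i} * prob {\<omega>\<in>space M. e \<omega> \<in> E}"
    if B: "\<And>i. i \<in> P \<Longrightarrow> B i \<in> sets borel" and E[measurable]: "E \<in> sets borel" for B E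
  proof -
    define I where "I J \<omega> = (\<Prod>j\<in>J. indicator (B j) (Y j \<omega>) :: real)" for J \<omega>
    have I_meas: "I J \<in> borel_measurable M" if "J \<subseteq> P" for J
    proof -
      have "(\<lambda>\<omega>. indicator (B j) (Y j \<omega>) :: real) \<in> borel_measurable M" if "j \<in> J" for j
        using B[OF subsetD[OF \<open>J \<subseteq> P\<close> that]] by measurable
      then show ?thesis unfolding I_def by measurable
    qed
    have I_bd: "\<bar>I J \<omega>\<bar> \<le> 1" "0 \<le> I J \<omega>" for J \<omega>
    proof -
      show "0 \<le> I J \<omega>" unfolding I_def by (intro prod_nonneg) auto
      moreover have "I J \<omega> \<le> 1" unfolding I_def by (intro prod_le_1) (auto simp: indicator_def)
      ultimately show "\<bar>I J \<omega>\<bar> \<le> 1" by simp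
    qed
    have int: "integrable M (\<lambda>\<omega>. I J \<omega> * cos (g \<omega>))" if "J \<subseteq> P" "g \<in> borel_measurable M" for J g
    proof (rule integrable_const_bound[of _ 1])
      show "AE \<omega> in M. norm (I J \<omega> * cos (g \<omega>)) \<le> 1"
        using I_bd by (auto simp: abs_mult intro!: mult_le_one)
    qed (use that I_meas in measurable)
    \<comment> \<open>The indicators of the box are inserted one coordinate at a time;
      \<open>factor\<close> is the case without indicators.\<close>
    have partial: "expectation (\<lambda>\<omega>. I J \<omega> * cos (L c \<omega> + r * e \<omega> + \<theta>))
        = f r * expectation (\<lambda>\<omega>. I J \<omega> * cos (L c \<omega> + \<theta>))"
      if "finite J" "J \<subseteq> P" for J c r \<theta>
      using that
    proof (induction J arbitrary: c r \<theta> rule: finite_induct)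
      case empty
      then show ?case using factor[of c r \<theta>] by (simp add: I_def L_def)
    next
      case (insert k J)
      then have k: "k \<in> P" and J: "J \<subseteq> P" by auto
      note [measurable] = I_meas[OF J]
      \<comment> \<open>The difference of the two sides before the indicator of \<open>B k\<close>
        is inserted. It has to be orthogonal to that indicator, for which trigonometric test
        functions of \<open>Y k\<close> suffice.\<close>
      define W where "W \<omega> = I J \<omega> * cos (L c \<omega> + r * e \<omega> + \<theta>) - f r * (I J \<omega> * cos (L c \<omega> + \<theta>))" for \<omega>
      have shifted: "expectation (\<lambda>\<omega>. I J \<omega> * cos (L c \<omega> + t * Y k \<omega> + r * e \<omega> + \<theta>')
           - f r * (I J \<omega> * cos (L c \<omega> + t * Y k \<omega> + \<theta>'))) = 0" for t \<theta>'
        using insert.IH[OF J, of "c(k := c k + t)" r \<theta>']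
        by (simp add: L_upd[OF k] Bochner_Integration.integral_diff int[OF J] del: fun_upd_apply)
      have shifted_int: "integrable M (\<lambda>\<omega>. I J \<omega> * cos (L c \<omega> + t * Y k \<omega> + r * e \<omega> + \<theta>')
           - f r * (I J \<omega> * cos (L c \<omega> + t * Y k \<omega> + \<theta>')))" for t \<theta>'
        by (intro Bochner_Integration.integrable_diff integrable_mult_right int[OF J]) measurable
      \<comment> \<open>Product-to-sum: both terms are instances of the induction hypothesis, with
        the coefficient of \<open>Y k\<close> moved by \<open>t\<close> or \<open>-t\<close> and the
        phase by \<open>s\<close> or \<open>-s\<close>.\<close>
      have trig: "W \<omega> * cos (t * Y k \<omega> + s) =
          ((I J \<omega> * cos (L c \<omega> + t * Y k \<omega> + r * e \<omega> + (\<theta> + s))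
             - f r * (I J \<omega> * cos (L c \<omega> + t * Y k \<omega> + (\<theta> + s))))
          + (I J \<omega> * cos (L c \<omega> + (-t) * Y k \<omega> + r * e \<omega> + (\<theta> - s))
             - f r * (I J \<omega> * cos (L c \<omega> + (-t) * Y k \<omega> + (\<theta> - s))))) / 2" for t s \<omega>
      proof -
        have cc: "cos x * cos y = (cos (x + y) + cos (x - y)) / 2" for x y :: real
          by (simp add: cos_add cos_diff)
        have "W \<omega> * cos (t * Y k \<omega> + s) =
            I J \<omega> * (cos (L c \<omega> + r * e \<omega> + \<theta>) * cos (t * Y k \<omega> + s))
            - f r * (I J \<omega> * (cos (L c \<omega> + \<theta>) * cos (t * Y k \<omega> + s)))"
          by (simp add: W_def algebra_simps)
        also have "\<dots> = I J \<omega> * ((cos (L c \<omega> + t * Y k \<omega> + r * e \<omega> + (\<theta> + s))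
             + cos (L c \<omega> + (-t) * Y k \<omega> + r * e \<omega> + (\<theta> - s))) / 2)
            - f r * (I J \<omega> * ((cos (L c \<omega> + t * Y k \<omega> + (\<theta> + s))
             + cos (L c \<omega> + (-t) * Y k \<omega> + (\<theta> - s))) / 2))"
          unfolding cc by (simp add: algebra_simps)
        finally show ?thesis by (simp add: algebra_simps add_divide_distrib diff_divide_distrib)
      qed
      have zero: "expectation (\<lambda>\<omega>. W \<omega> * cos (t * Y k \<omega> + s)) = 0" for t s
        unfolding trig
        by (subst integral_divide_zero, subst Bochner_Integration.integral_add[OF shifted_int shifted_int])
           (simp only: shifted, simp)
      have "expectation (\<lambda>\<omega>. W \<omega> * indicator (B k) (Y k \<omega>)) = 0"
      proof (rule signed_weight_orthogonal[where C = "1 + \<bar>f r\<bar>"])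
        show "W \<in> borel_measurable M" unfolding W_def by measurable
        show "\<bar>W \<omega>\<bar> \<le> 1 + \<bar>f r\<bar>" for \<omega>
        proof -
          have "\<bar>I J \<omega> * cos x\<bar> \<le> 1" for x using I_bd by (auto simp: abs_mult intro!: mult_le_one)
          then have "\<bar>I J \<omega> * cos (L c \<omega> + r * e \<omega> + \<theta>)\<bar> \<le> 1"
            "\<bar>f r * (I J \<omega> * cos (L c \<omega> + \<theta>))\<bar> \<le> \<bar>f r\<bar>"
            by (auto simp: abs_mult[of "f r"] intro: mult_left_le)
          then show ?thesis unfolding W_def by linarith
        qed
        show "expectation (\<lambda>\<omega>. W \<omega> * cos (t * Y k \<omega>)) = 0" for t using zero[of t 0] by simp
        \<comment> \<open>The phase \<open>- pi / 2\<close> turns the cosine into a sine.\<close>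
        show "expectation (\<lambda>\<omega>. W \<omega> * sin (t * Y k \<omega>)) = 0" for t
          using zero[of t "- pi / 2"] by (simp add: cos_diff)
        show "B k \<in> sets borel" using B k by auto
      qed simp
      moreover have "W \<omega> * indicator (B k) (Y k \<omega>) = I (insert k J) \<omega> * cos (L c \<omega> + r * e \<omega> + \<theta>)
          - f r * (I (insert k J) \<omega> * cos (L c \<omega> + \<theta>))" for \<omega>
        unfolding I_def W_def using insert by (simp add: algebra_simps)
      ultimately show ?case
        using int[OF insert.prems, of "\<lambda>\<omega>. L c \<omega> + r * e \<omega> + \<theta>"] int[OF insert.prems, of "\<lambda>\<omega>. L c \<omega> + \<theta>"]
        by (simp add: Bochner_Integration.integral_diff)
    qed
    note [measurable] = I_meas[OF subset_refl]
    define p where "p = expectation (I P)"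
    have int_I: "integrable M (I P)"
      using I_bd by (intro integrable_const_bound[of _ 1]) auto
    \<comment> \<open>With zero coefficients, \<open>factor\<close> identifies
      \<open>f r * cos \<theta>\<close> as the mean of
      \<open>cos (r * e \<omega> + \<theta>)\<close>. Hence \<open>I P - p\<close> is orthogonal to
      trigonometric functions of \<open>e\<close>, and the indicator of \<open>E\<close> is inserted
      as the others were.\<close>
    have zero: "expectation (\<lambda>\<omega>. (I P \<omega> - p) * cos (r * e \<omega> + \<theta>)) = 0" for r \<theta>
    proof -
      have "expectation (\<lambda>\<omega>. I P \<omega> * cos (r * e \<omega> + \<theta>)) = f r * (p * cos \<theta>)"
        using partial[OF P subset_refl, of "\<lambda>_. 0" r \<theta>] by (simp add: L_def p_def)
      moreover have "expectation (\<lambda>\<omega>. cos (r * e \<omega> + \<theta>)) = f r * cos \<theta>"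
        using factor[of "\<lambda>_. 0" r \<theta>] by (simp add: prob_space)
      moreover have "integrable M (\<lambda>\<omega>. cos (r * e \<omega> + \<theta>))"
        by (intro integrable_const_bound[of _ 1]) auto
      ultimately show ?thesis
        using int[OF subset_refl, of "\<lambda>\<omega>. r * e \<omega> + \<theta>"]
        by (simp add: algebra_simps Bochner_Integration.integral_diff)
    qed
    have "expectation (\<lambda>\<omega>. (I P \<omega> - p) * indicator E (e \<omega>)) = 0"
    proof (rule signed_weight_orthogonal[where C = "1 + \<bar>p\<bar>"])
      show "\<bar>I P \<omega> - p\<bar> \<le> 1 + \<bar>p\<bar>" for \<omega> using I_bd(1)[of P \<omega>] by linarith
      show "expectation (\<lambda>\<omega>. (I P \<omega> - p) * cos (t * e \<omega>)) = 0" for t using zero[of t 0] by simp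
      show "expectation (\<lambda>\<omega>. (I P \<omega> - p) * sin (t * e \<omega>)) = 0" for t
        using zero[of t "- pi / 2"] by (simp add: cos_diff)
    qed simp_all
    moreover have "integrable M (\<lambda>\<omega>. I P \<omega> * indicator E (e \<omega>))"
    proof (rule integrable_const_bound[of _ 1])
      show "AE \<omega> in M. norm (I P \<omega> * indicator E (e \<omega>)) \<le> 1"
        using I_bd by (auto simp: abs_mult intro!: mult_le_one)
    qed simp
    moreover have "integrable M (\<lambda>\<omega>. indicator E (e \<omega>) :: real)"
      by (intro integrable_const_bound[of _ 1]) (auto simp: indicator_def)
    ultimately have prod: "expectation (\<lambda>\<omega>. I P \<omega> * indicator E (e \<omega>))
        = p * expectation (\<lambda>\<omega>. indicator E (e \<omega>))"
      by (simp add: algebra_simps Bochner_Integration.integral_diff)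
    have I_ind: "I P \<omega> = indicator {\<omega>. \<forall>i\<in>P. Y i \<omega> \<in> B i} \<omega>" for \<omega>
      unfolding I_def using P by (auto simp: indicator_def prod_zero_iff)
    have S[measurable]: "{\<omega>\<in>space M. \<forall>i\<in>P. Y i \<omega> \<in> B i} \<in> sets M"
    proof -
      have "{\<omega>\<in>space M. Y i \<omega> \<in> B i} \<in> sets M" if "i \<in> P" for i using B[OF that] by measurable
      then show ?thesis using P by (intro sets.sets_Collect_finite_All)
    qed
    have "prob {\<omega>\<in>space M. (\<forall>i\<in>P. Y i \<omega> \<in> B i) \<and> e \<omega> \<in> E}
        = expectation (\<lambda>\<omega>. indicator {\<omega>\<in>space M. (\<forall>i\<in>P. Y i \<omega> \<in> B i) \<and> e \<omega> \<in> E} \<omega>)"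
      by simp
    also have "\<dots> = expectation (\<lambda>\<omega>. I P \<omega> * indicator E (e \<omega>))"
      by (intro Bochner_Integration.integral_cong refl) (auto simp: I_ind indicator_def)
    also have "\<dots> = p * expectation (\<lambda>\<omega>. indicator E (e \<omega>))" by (rule prod)
    also have "p = expectation (\<lambda>\<omega>. indicator {\<omega>\<in>space M. \<forall>i\<in>P. Y i \<omega> \<in> B i} \<omega>)"
      unfolding p_def by (intro Bochner_Integration.integral_cong refl) (auto simp: I_ind indicator_def)
    also have "\<dots> = prob {\<omega>\<in>space M. \<forall>i\<in>P. Y i \<omega> \<in> B i}"
      by simp
    also have "expectation (\<lambda>\<omega>. indicator E (e \<omega>)) = expectation (\<lambda>\<omega>. indicator {\<omega>\<in>space M. e \<omega> \<in> E} \<omega>)"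
      by (intro Bochner_Integration.integral_cong refl) (auto simp: indicator_def)
    also have "\<dots> = prob {\<omega>\<in>space M. e \<omega> \<in> E}"
      by simp
    finally show ?thesis .
  qed
  let ?Q = "PiM P (\<lambda>_. borel :: real measure)"
  let ?U = "\<lambda>\<omega>. \<lambda>i\<in>P. Y i \<omega>"
  have rect: "emeasure M (?U -` A \<inter> e -` E \<inter> space M)
      = emeasure M (?U -` A \<inter> space M) * emeasure M (e -` E \<inter> space M)"
    if A: "A \<in> sets ?Q" and E[measurable]: "E \<in> sets borel" for A E
  proof -
    \<comment> \<open>For fixed \<open>E\<close> both sides of the claim are finite measures in
      \<open>A\<close>. By \<open>box\<close> they agree on boxes, an intersection-stable
      generator.\<close>
    define R where "R = distr (density M (\<lambda>\<omega>. indicator E (e \<omega>))) ?Q ?U"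
    define T where "T = scale_measure (emeasure M (e -` E \<inter> space M)) (distr M ?Q ?U)"
    have R: "emeasure R A = emeasure M (?U -` A \<inter> e -` E \<inter> space M)" if "A \<in> sets ?Q" for A
    proof -
      have [measurable]: "?U -` A \<inter> space M \<in> sets M" using that by measurable
      have "emeasure R A = (\<integral>\<^sup>+\<omega>. indicator E (e \<omega>) * indicator (?U -` A \<inter> space M) \<omega> \<partial>M)"
        unfolding R_def using that by (simp add: emeasure_distr emeasure_density)
      also have "\<dots> = (\<integral>\<^sup>+\<omega>. indicator ((?U -` A \<inter> space M) \<inter> (e -` E \<inter> space M)) \<omega> \<partial>M)"
        by (intro nn_integral_cong) (auto simp: indicator_def)
      also have "\<dots> = emeasure M ((?U -` A \<inter> space M) \<inter> (e -` E \<inter> space M))"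
        by (intro nn_integral_indicator) measurable
      finally show ?thesis by (simp add: Int_ac)
    qed
    have T: "emeasure T A = emeasure M (?U -` A \<inter> space M) * emeasure M (e -` E \<inter> space M)"
      if "A \<in> sets ?Q" for A
      unfolding T_def using that by (simp add: emeasure_distr mult.commute)
    have "R = T"
    proof (rule measure_eqI_PiM_finite[where M = "\<lambda>_. borel :: real measure" and I = P
          and A = "\<lambda>_. \<Pi>\<^sub>E i\<in>P. UNIV"])
      fix B :: "'i \<Rightarrow> real set" assume B: "\<And>i. i \<in> P \<Longrightarrow> B i \<in> sets borel"
      have sB: "Pi\<^sub>E P B \<in> sets ?Q" using P B by (intro sets_PiM_I_finite) auto
      have U: "?U \<omega> \<in> Pi\<^sub>E P B \<longleftrightarrow> (\<forall>i\<in>P. Y i \<omega> \<in> B i)" for \<omega> by (auto simp: PiE_iff)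
      have "emeasure R (Pi\<^sub>E P B) = emeasure M {\<omega>\<in>space M. (\<forall>i\<in>P. Y i \<omega> \<in> B i) \<and> e \<omega> \<in> E}"
        unfolding R[OF sB] by (intro arg_cong[where f = "emeasure M"]) (auto simp: U[symmetric])
      also have "\<dots> = emeasure M {\<omega>\<in>space M. \<forall>i\<in>P. Y i \<omega> \<in> B i} * emeasure M {\<omega>\<in>space M. e \<omega> \<in> E}"
        using box[of B E] B by (simp add: emeasure_eq_measure ennreal_mult)
      also have "\<dots> = emeasure T (Pi\<^sub>E P B)"
        unfolding T[OF sB] by (intro arg_cong2[where f = "(*)"] arg_cong[where f = "emeasure M"]) (auto simp: U[symmetric])
      finally show "emeasure R (Pi\<^sub>E P B) = emeasure T (Pi\<^sub>E P B)" .
    next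
      show "range (\<lambda>_::nat. \<Pi>\<^sub>E i\<in>P. UNIV) \<subseteq> prod_algebra P (\<lambda>_. borel :: real measure)"
        using P by (auto intro!: prod_algebraI_finite)
      show "emeasure R (\<Pi>\<^sub>E i\<in>P. UNIV) \<noteq> \<infinity>"
      proof -
        have "(\<Pi>\<^sub>E i\<in>P. UNIV) \<in> sets ?Q" using P by (intro sets_PiM_I_finite) auto
        from R[OF this] show ?thesis by simp
      qed
    qed (use P in \<open>auto simp: R_def T_def space_PiM\<close>)
    then show ?thesis using R[OF A] T[OF A] by simp
  qed
  show ?thesis
  proof (rule pair_measure_eqI)
    show "sigma_finite_measure (distr M ?Q ?U)" "sigma_finite_measure (distr M borel e)"
      by (auto intro!: prob_space_imp_sigma_finite prob_space_distr)
    show "sets (distr M ?Q ?U \<Otimes>\<^sub>M distr M borel e) = sets (distr M (?Q \<Otimes>\<^sub>M borel) (\<lambda>\<omega>. (?U \<omega>, e \<omega>)))"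
      by (simp cong: sets_pair_measure_cong)
    fix A E assume "A \<in> sets (distr M ?Q ?U)" "E \<in> sets (distr M borel e)"
    then have [measurable]: "A \<in> sets ?Q" "E \<in> sets borel" by auto
    have "(\<lambda>\<omega>. (?U \<omega>, e \<omega>)) -` (A \<times> E) \<inter> space M = ?U -` A \<inter> e -` E \<inter> space M" by auto
    then show "emeasure (distr M ?Q ?U) A * emeasure (distr M borel e) E
        = emeasure (distr M (?Q \<Otimes>\<^sub>M borel) (\<lambda>\<omega>. (?U \<omega>, e \<omega>))) (A \<times> E)"
      by (simp add: emeasure_distr rect)
  qed
qed

section \<open>Moments, density and distribution function of a single Gaussian variable\<close>

lemma (in prob_space) centered_gaussian_moments:
  assumes "centered_gaussian M Y"
  shows "Y \<in> borel_measurable M" "integrable M (\<lambda>\<omega>. (Y \<omega>)\<^sup>2)" "expectation Y = 0"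
    "expectation (\<lambda>\<omega>. cos (Y \<omega> + \<theta>)) = exp (- expectation (\<lambda>\<omega>. (Y \<omega>)\<^sup>2) / 2) * cos \<theta>"
proof -
  show Y[measurable]: "Y \<in> borel_measurable M" using assms by (simp add: centered_gaussian_def)
  consider "AE \<omega> in M. Y \<omega> = 0" | \<sigma> where "\<sigma> > 0" "distributed M lborel Y (normal_density 0 \<sigma>)"
    using assms by (auto simp: centered_gaussian_def)
  then have "integrable M (\<lambda>\<omega>. (Y \<omega>)\<^sup>2) \<and> expectation Y = 0 \<and>
    expectation (\<lambda>\<omega>. cos (Y \<omega> + \<theta>)) = exp (- expectation (\<lambda>\<omega>. (Y \<omega>)\<^sup>2) / 2) * cos \<theta>"
  proof cases
    case 1
    have "integrable M (\<lambda>\<omega>. (Y \<omega>)\<^sup>2) \<longleftrightarrow> integrable M (\<lambda>\<omega>. 0::real)"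
      using 1 by (intro integrable_cong_AE) auto
    moreover have "expectation (\<lambda>\<omega>. (Y \<omega>)\<^sup>2) = expectation (\<lambda>\<omega>. 0)"
      using 1 by (intro integral_cong_AE) auto
    moreover have "expectation Y = expectation (\<lambda>\<omega>. 0)"
      using 1 by (intro integral_cong_AE) auto
    moreover have "expectation (\<lambda>\<omega>. cos (Y \<omega> + \<theta>)) = expectation (\<lambda>\<omega>. cos \<theta>)"
      using 1 by (intro integral_cong_AE) auto
    ultimately show ?thesis by (simp add: prob_space)
  next
    case 2
    have E0: "expectation Y = 0" using normal_distributed_expectation[OF 2] .
    have V: "expectation (\<lambda>\<omega>. (Y \<omega>)\<^sup>2) = \<sigma>\<^sup>2" using normal_distributed_variance[OF 2] E0 by simp
    have int: "integrable M (\<lambda>\<omega>. (Y \<omega>)\<^sup>2)"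
      using distributed_integrable[OF 2(2), of "\<lambda>x. x\<^sup>2"] integrable_normal_moment[OF 2(1), of 0 2] by simp
    \<comment> \<open>Rescaling reduces the claim to the characteristic function of the standard
      normal law at \<open>\<sigma>\<close>. Its real part gives the cosine mean, its imaginary part
      the vanishing sine mean.\<close>
    define Z where "Z \<omega> = Y \<omega> / \<sigma>" for \<omega>
    have Z: "distributed M lborel Z std_normal_density"
      using 2 normal_standard_normal_convert[OF 2(1), of Y 0] by (simp add: Z_def[abs_def])
    have [measurable]: "Z \<in> borel_measurable M" unfolding Z_def by measurable
    have "(CLINT \<omega>|M. iexp (Y \<omega>)) = (CLINT \<omega>|M. iexp (\<sigma> * Z \<omega>))"
      using 2(1) by (simp add: Z_def)
    also have "\<dots> = (CLINT x|distr M lborel Z. iexp (\<sigma> * x))" by (subst integral_distr) auto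
    also have "\<dots> = char std_normal_distribution \<sigma>"
      unfolding distributed_distr_eq_density[OF Z] char_def ..
    also have "\<dots> = complex_of_real (exp (- \<sigma>\<^sup>2 / 2))" by (simp add: char_std_normal_distribution)
    finally have ch: "(CLINT \<omega>|M. iexp (Y \<omega>)) = complex_of_real (exp (- \<sigma>\<^sup>2 / 2))" .
    have i: "integrable M (\<lambda>\<omega>. iexp (Y \<omega>))" by (rule integrable_iexp) auto
    have c: "expectation (\<lambda>\<omega>. cos (Y \<omega>)) = exp (- \<sigma>\<^sup>2 / 2)"
      using arg_cong[OF ch, of Re] integral_Re[OF i] by (simp add: Re_exp)
    have s: "expectation (\<lambda>\<omega>. sin (Y \<omega>)) = 0"
      using arg_cong[OF ch, of Im] integral_Im[OF i] by (simp add: Im_exp)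
    have ics: "integrable M (\<lambda>\<omega>. cos (Y \<omega>))" "integrable M (\<lambda>\<omega>. sin (Y \<omega>))"
      by (auto intro!: integrable_const_bound[of _ 1])
    have "expectation (\<lambda>\<omega>. cos (Y \<omega> + \<theta>)) = exp (- \<sigma>\<^sup>2 / 2) * cos \<theta>"
      using ics by (simp add: cos_add c s)
    then show ?thesis using int E0 V by simp
  qed
  then show "integrable M (\<lambda>\<omega>. (Y \<omega>)\<^sup>2)" "expectation Y = 0"
    "expectation (\<lambda>\<omega>. cos (Y \<omega> + \<theta>)) = exp (- expectation (\<lambda>\<omega>. (Y \<omega>)\<^sup>2) / 2) * cos \<theta>"
    by auto
qed

text \<open>A positive second moment rules out the point mass and determines the standard
  deviation.\<close>

lemma (in prob_space) centered_gaussian_distributed: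
  assumes "centered_gaussian M Y" and v: "expectation (\<lambda>\<omega>. (Y \<omega>)\<^sup>2) = v" "v > 0"
  shows "distributed M lborel Y (normal_density 0 (sqrt v))"
proof -
  have Y[measurable]: "Y \<in> borel_measurable M" using assms by (simp add: centered_gaussian_def)
  have "\<not> (AE \<omega> in M. Y \<omega> = 0)"
  proof
    assume "AE \<omega> in M. Y \<omega> = 0"
    then have "expectation (\<lambda>\<omega>. (Y \<omega>)\<^sup>2) = expectation (\<lambda>\<omega>. 0)" by (intro integral_cong_AE) auto
    then show False using v by simp
  qed
  then obtain \<sigma> where \<sigma>: "\<sigma> > 0" "distributed M lborel Y (normal_density 0 \<sigma>)"
    using assms(1) by (auto simp: centered_gaussian_def)
  then have "v = \<sigma>\<^sup>2"
    using v normal_distributed_variance[OF \<sigma>] normal_distributed_expectation[OF \<sigma>] by simp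
  then have "sqrt v = \<sigma>" using \<sigma> by simp
  then show ?thesis using \<sigma> by simp
qed

text \<open>By symmetry, twice the probability is one plus the mass of \<open>{-a..a}\<close>, on
  which the density is at least its value at the endpoint.\<close>

lemma (in prob_space) std_normal_cdf_ge:
  assumes X: "distributed M lborel X std_normal_density" and a: "a > 0"
  shows "prob {\<omega>\<in>space M. X \<omega> \<le> a} \<ge> 1 / 2 + a * std_normal_density a"
proof -
  have [measurable]: "X \<in> borel_measurable M" using distributed_measurable[OF X] by simp
  have X': "distributed M lborel (\<lambda>\<omega>. - X \<omega>) std_normal_density"
    using normal_density_affine[OF X, of "-1" 0] by simp
  have sym: "emeasure M {\<omega>\<in>space M. X \<omega> \<le> a} = emeasure M {\<omega>\<in>space M. - X \<omega> \<le> a}"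
    using distributed_emeasure[OF X, of "{..a}"] distributed_emeasure[OF X', of "{..a}"]
    by (simp add: vimage_def Int_def conj_commute)
  have "ennreal (2 * a * std_normal_density a)
      = (\<integral>\<^sup>+x. ennreal (std_normal_density a) * indicator {-a..a} x \<partial>lborel)"
    using a by (simp add: nn_integral_cmult_indicator ennreal_mult[symmetric] mult_ac)
  also have "\<dots> \<le> (\<integral>\<^sup>+x. ennreal (std_normal_density x) * indicator {-a..a} x \<partial>lborel)"
  proof (intro nn_integral_mono)
    fix x :: real
    have "std_normal_density a \<le> std_normal_density x" if "x \<in> {-a..a}"
    proof -
      have "x\<^sup>2 \<le> a\<^sup>2" using that by (intro abs_le_square_iff[THEN iffD1]) auto
      then show ?thesis unfolding std_normal_density_def by (intro mult_left_mono) auto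
    qed
    then show "ennreal (std_normal_density a) * indicator {-a..a} x
        \<le> ennreal (std_normal_density x) * indicator {-a..a} x"
      by (auto simp: indicator_def intro: ennreal_leI)
  qed
  also have "\<dots> = emeasure M {\<omega>\<in>space M. -a \<le> X \<omega> \<and> X \<omega> \<le> a}"
    using distributed_emeasure[OF X, of "{-a..a}"] by (simp add: vimage_def Int_def conj_commute)
  finally have "2 * a * std_normal_density a \<le> prob {\<omega>\<in>space M. -a \<le> X \<omega> \<and> X \<omega> \<le> a}"
    using a by (simp add: emeasure_eq_measure)
  moreover have "prob {\<omega>\<in>space M. X \<omega> \<le> a} + prob {\<omega>\<in>space M. - X \<omega> \<le> a}
      = prob (space M) + prob {\<omega>\<in>space M. -a \<le> X \<omega> \<and> X \<omega> \<le> a}"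
  proof -
    have "prob {\<omega>\<in>space M. X \<omega> \<le> a} = prob {\<omega>\<in>space M. X \<omega> < -a} + prob {\<omega>\<in>space M. -a \<le> X \<omega> \<and> X \<omega> \<le> a}"
      using a by (subst finite_measure_Union[symmetric]) (auto intro!: arg_cong[where f = prob])
    moreover have "prob (space M) = prob {\<omega>\<in>space M. X \<omega> < -a} + prob {\<omega>\<in>space M. - X \<omega> \<le> a}"
      by (subst finite_measure_Union[symmetric]) (auto intro!: arg_cong[where f = prob])
    ultimately show ?thesis by simp
  qed
  ultimately show ?thesis using sym by (simp add: emeasure_eq_measure prob_space)
qed

section \<open>The integral over one new Gaussian variable\<close>

definition step_const :: "real \<Rightarrow> real \<Rightarrow> real" where
  "step_const \<tau> b = exp (1 / 6 + (b + 2) * \<tau>) / (sqrt (pi / 6) * (b + 2))"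

text \<open>The log-density lies below its tangent line at \<open>-1/6\<close>.\<close>

lemma normal_density_le_exp: "normal_density 0 (sqrt (1 / 12)) x \<le> exp (1 / 6 + 2 * x) / sqrt (pi / 6)"
proof -
  have "0 \<le> 6 * (x + 1 / 6)\<^sup>2" by simp
  then have "- (x\<^sup>2) / (2 * (sqrt (1 / 12))\<^sup>2) \<le> 1 / 6 + 2 * x"
    by (simp add: power2_eq_square algebra_simps)
  then have "exp (- (x\<^sup>2) / (2 * (sqrt (1 / 12))\<^sup>2)) / sqrt (pi / 6) \<le> exp (1 / 6 + 2 * x) / sqrt (pi / 6)"
    by (intro divide_right_mono) (auto simp del: real_sqrt_pow2)
  then show ?thesis by (simp add: normal_density_def)
qed

text \<open>Here \<open>m\<close> stands for the part of a new value determined by the past and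
  \<open>x\<close> for the independent remainder. With the density replaced by its exponential bound
  the integral is elementary and equals the right-hand side; the slope 2 of that bound produces
  \<open>exp (- 2 * m)\<close>.\<close>

lemma normal_exp_bound:
  assumes b: "b \<ge> 0"
  shows "(\<integral>\<^sup>+x. ennreal (normal_density 0 (sqrt (1 / 12)) x) *
      ennreal (exp (b * (m + x)) * of_bool (m + x \<le> \<tau>)) \<partial>lborel)
    \<le> ennreal (step_const \<tau> b * exp (- 2 * m))"
proof -
  define K where "K = exp (1 / 6 + (b + 2) * \<tau> - 2 * m) / sqrt (pi / 6)"
  have "(\<integral>\<^sup>+x. ennreal (normal_density 0 (sqrt (1 / 12)) x) *
      ennreal (exp (b * (m + x)) * of_bool (m + x \<le> \<tau>)) \<partial>lborel)
    \<le> (\<integral>\<^sup>+x. ennreal (exp (1 / 6 + 2 * x) / sqrt (pi / 6) * (exp (b * (m + x)) * of_bool (m + x \<le> \<tau>))) \<partial>lborel)"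
    by (intro nn_integral_mono, subst ennreal_mult[symmetric])
       (auto simp del: times_divide_eq_left intro!: ennreal_leI mult_right_mono normal_density_le_exp)
  \<comment> \<open>The substitution \<open>x = \<tau> - m - t\<close> maps the half-line below the
    threshold to \<open>t \<ge> 0\<close>.\<close>
  also have "\<dots> = (\<integral>\<^sup>+t. ennreal (exp (1 / 6 + 2 * (\<tau> - m + (-1) * t)) / sqrt (pi / 6) *
      (exp (b * (m + (\<tau> - m + (-1) * t))) * of_bool (m + (\<tau> - m + (-1) * t) \<le> \<tau>))) \<partial>lborel)"
    by (subst nn_integral_real_affine[where c = "-1" and t = "\<tau> - m"]) auto
  also have "\<dots> = (\<integral>\<^sup>+t. ennreal (K * exp (- (b + 2) * t)) * indicator {0..} t \<partial>lborel)"
  proof (intro nn_integral_cong)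
    fix t
    have "exp (1 / 6 + 2 * (\<tau> - m + (-1) * t)) * exp (b * (m + (\<tau> - m + (-1) * t)))
        = exp (1 / 6 + (b + 2) * \<tau> - 2 * m) * exp (- (b + 2) * t)"
      unfolding exp_add[symmetric] by (intro arg_cong[where f = exp]) (simp add: algebra_simps)
    then show "ennreal (exp (1 / 6 + 2 * (\<tau> - m + (-1) * t)) / sqrt (pi / 6) *
        (exp (b * (m + (\<tau> - m + (-1) * t))) * of_bool (m + (\<tau> - m + (-1) * t) \<le> \<tau>)))
        = ennreal (K * exp (- (b + 2) * t)) * indicator {0..} t"
      by (auto simp: K_def indicator_def)
  qed
  also have "\<dots> = ennreal (0 - (- (K / (b + 2)) * exp (- (b + 2) * 0)))"
  proof (rule nn_integral_FTC_atLeast[where F = "\<lambda>t. - (K / (b + 2)) * exp (- (b + 2) * t)"])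
    show "((\<lambda>t. - (K / (b + 2)) * exp (- (b + 2) * t)) has_real_derivative K * exp (- (b + 2) * x)) (at x)" for x
    proof -
      have "((\<lambda>t. - (K / c) * exp (- c * t)) has_real_derivative K * exp (- c * x)) (at x)" if "c \<noteq> 0" for c
        using that by (auto intro!: derivative_eq_intros)
      from this[of "b + 2"] b show ?thesis by simp
    qed
    have "LIM t at_top. - (b + 2) * t :> at_bot"
      using b by (intro filterlim_tendsto_neg_mult_at_bot[OF tendsto_const]) (auto simp: filterlim_ident)
    then have "((\<lambda>t. exp (- (b + 2) * t)) \<longlongrightarrow> 0) at_top"
      by (rule filterlim_compose[OF exp_at_bot])
    from tendsto_mult_left[OF this, of "- (K / (b + 2))"]
    show "((\<lambda>t. - (K / (b + 2)) * exp (- (b + 2) * t)) \<longlongrightarrow> 0) at_top" by simp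
  qed (auto simp: K_def)
  also have "0 - (- (K / (b + 2)) * exp (- (b + 2) * 0)) = step_const \<tau> b * exp (- 2 * m)"
  proof -
    have "K = exp (1 / 6 + (b + 2) * \<tau>) / sqrt (pi / 6) * exp (- 2 * m)"
      unfolding K_def by (simp add: exp_add[symmetric])
    then show ?thesis by (simp add: step_const_def)
  qed
  finally show ?thesis .
qed

section \<open>The covariance of the wave function\<close>

locale wave = prob_space M + cubic_tree adj
  for M :: "'a measure" and adj :: "'v graph" +
  fixes X :: "'v \<Rightarrow> 'a \<Rightarrow> real"
  assumes gwf: "gaussian_wave_function adj (- 2 * sqrt 2) X"
begin

lemma gaussian_sum: "finite F \<Longrightarrow> centered_gaussian M (\<lambda>\<omega>. \<Sum>v\<in>F. c v * X v \<omega>)"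
  using gwf by (auto simp: gaussian_wave_function_def gaussian_process_def)

lemma gaussian_X: "centered_gaussian M (X v)"
  using gaussian_sum[of "{v}" "\<lambda>_. 1"] by simp

lemma X_measurable[measurable]: "X v \<in> borel_measurable M"
  using centered_gaussian_moments(1)[OF gaussian_X] .

lemma eigen: "AE \<omega> in M. \<forall>v. (\<Sum>u\<in>neighbors adj v. X u \<omega>) = - 2 * sqrt 2 * X v \<omega>"
  using gwf by (simp add: gaussian_wave_function_def)

text \<open>This is the covariance because the variables are centered.\<close>

definition cov :: "'v \<Rightarrow> 'v \<Rightarrow> real" where
  "cov u v = expectation (\<lambda>\<omega>. X u \<omega> * X v \<omega>)"

lemma cov_sym: "cov u v = cov v u"
  by (simp add: cov_def mult.commute)

lemma cov_self: "cov v v = 1"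
proof -
  have "variance (X v) = 1" using gwf by (simp add: gaussian_wave_function_def)
  then show ?thesis
    using centered_gaussian_moments(3)[OF gaussian_X[of v]] by (simp add: cov_def power2_eq_square)
qed

lemma integrable_XX: "integrable M (\<lambda>\<omega>. X u \<omega> * X v \<omega>)"
proof (rule Bochner_Integration.integrable_bound)
  show "integrable M (\<lambda>\<omega>. (X u \<omega>)\<^sup>2 + (X v \<omega>)\<^sup>2)"
    using centered_gaussian_moments(2)[OF gaussian_X] by auto
  have "\<bar>x * y\<bar> \<le> x\<^sup>2 + y\<^sup>2" for x y :: real
  proof -
    have "2 * (\<bar>x\<bar> * \<bar>y\<bar>) \<le> x\<^sup>2 + y\<^sup>2"
      using zero_le_power2[of "\<bar>x\<bar> - \<bar>y\<bar>"] by (simp add: power2_diff)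
    moreover have "0 \<le> \<bar>x\<bar> * \<bar>y\<bar>" by simp
    ultimately show ?thesis unfolding abs_mult by linarith
  qed
  then show "AE \<omega> in M. norm (X u \<omega> * X v \<omega>) \<le> norm ((X u \<omega>)\<^sup>2 + (X v \<omega>)\<^sup>2)"
    by (simp add: sum_power2_ge_zero)
qed simp

text \<open>A covariance is the integral of a product of two coordinates against the process law, so
  invariance of the law carries over.\<close>

lemma cov_automorphism:
  assumes "graph_automorphism adj \<phi>"
  shows "cov (\<phi> u) (\<phi> v) = cov u v"
proof -
  let ?N = "PiM UNIV (\<lambda>_. borel) :: ('v \<Rightarrow> real) measure"
  have law: "process_law M (\<lambda>v. X (\<phi> v)) = process_law M X"
    using gwf assms by (simp add: gaussian_wave_function_def invariant_process_def)
  have *: "(\<integral>g. g u * g v \<partial>process_law M Z) = expectation (\<lambda>\<omega>. Z u \<omega> * Z v \<omega>)"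
    if "\<And>v. Z v \<in> borel_measurable M" for Z :: "'v \<Rightarrow> 'a \<Rightarrow> real"
  proof -
    have [measurable]: "(\<lambda>\<omega> v. Z v \<omega>) \<in> measurable M ?N"
      using that by (intro measurable_PiM_single') auto
    have [measurable]: "(\<lambda>g. g x) \<in> borel_measurable ?N" for x
      by (rule measurable_component_singleton) simp
    show ?thesis unfolding process_law_def by (subst integral_distr) auto
  qed
  show ?thesis using *[of X] *[of "\<lambda>v. X (\<phi> v)"] law by (simp add: cov_def)
qed

lemma cov_eigen: "(\<Sum>u\<in>neighbors adj v. cov x u) = - 2 * sqrt 2 * cov x v"
proof -
  have "(\<Sum>u\<in>neighbors adj v. cov x u) = expectation (\<lambda>\<omega>. \<Sum>u\<in>neighbors adj v. X x \<omega> * X u \<omega>)"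
    unfolding cov_def by (subst Bochner_Integration.integral_sum) (auto intro: integrable_XX)
  also have "\<dots> = expectation (\<lambda>\<omega>. (- 2 * sqrt 2) * (X x \<omega> * X v \<omega>))"
  proof (rule integral_cong_AE)
    show "AE \<omega> in M. (\<Sum>u\<in>neighbors adj v. X x \<omega> * X u \<omega>) = (- 2 * sqrt 2) * (X x \<omega> * X v \<omega>)"
      using eigen by eventually_elim (simp add: sum_distrib_left[symmetric])
  qed auto
  also have "\<dots> = (- 2 * sqrt 2) * cov x v"
    unfolding cov_def by (rule integral_mult_right_zero)
  finally show ?thesis .
qed

text \<open>The reflection exchanging the branches at \<open>w\<close> and \<open>w'\<close> fixes
  every vertex of a walk from \<open>p\<close> that starts into neither of them.\<close>

lemma cov_siblings:
  assumes "adj p w" "adj p w'" "nb_walk adj (p # xs)" "xs \<noteq> [] \<Longrightarrow> hd xs \<noteq> w \<and> hd xs \<noteq> w'"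
    and "x \<in> set (p # xs)"
  shows "cov x w = cov x w'"
proof (cases "w = w'")
  case False
  have fixed: "swap_branches p w w' x = x" using swap_fixed[OF assms(1,2) False assms(3,4,5)] .
  have "swap_branches p w w' w = w'"
    using swap_node(1)[OF assms(1,2) False, of "[]"] by (simp add: node_def)
  with cov_automorphism[OF swap_automorphism[OF assms(1,2) False], of x w] fixed
  show ?thesis by simp
qed simp

text \<open>The three neighbors of \<open>p\<close> have equal covariances with \<open>p\<close>,
  and by the eigenvector equation these add up to \<open>- 2 * sqrt 2\<close>.\<close>

lemma cov_adj:
  assumes "adj p w"
  shows "cov p w = - 2 * sqrt 2 / 3"
proof -
  have "cov p u = cov p w" if "u \<in> neighbors adj p" for u
    using that assms by (intro cov_siblings[of p _ _ "[]"]) (auto simp: neighbors_def)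
  then have "(\<Sum>u\<in>neighbors adj p. cov p u) = 3 * cov p w"
    using card_neighbors[of p] by simp
  then show ?thesis using cov_eigen[where v = p and x = p] by (simp add: cov_self)
qed

text \<open>From \<open>w\<close>, the branches of \<open>y\<close> at \<open>x\<close> and
  \<open>w'\<close> look alike. The eigenvector equation at \<open>y\<close>, multiplied by
  \<open>X w\<close>, then reads \<open>1 + 2 * cov w w' = 8 / 3\<close>.\<close>

lemma cov_dist_2:
  assumes nb: "neighbors adj y = {x, w, w'}" "x \<noteq> w" "x \<noteq> w'" "w \<noteq> w'"
  shows "cov w w' = 5 / 6"
proof -
  have adjs: "adj y x" "adj y w" "adj y w'" using nb(1) by (auto simp: neighbors_def)
  have "cov w w' = cov w x"
    using nb adjs by (intro cov_siblings[of y _ _ "[w]"]) (auto intro: adj_sym)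
  then have "1 + 2 * cov w w' = (\<Sum>u\<in>neighbors adj y. cov w u)"
    using nb by (simp add: cov_self)
  also have "\<dots> = 8 / 3"
    using cov_eigen[where v = y and x = w] cov_adj[of y w] cov_sym[of w y] adjs by simp
  finally show ?thesis by simp
qed

section \<open>Decay along a path\<close>

text \<open>Position 0 holds the newest vertex. The exponential weight involves the two newest
  values because one step back along the path reproduces a weight of this shape.\<close>

definition path_weight :: "real \<Rightarrow> real \<Rightarrow> real \<Rightarrow> 'v list \<Rightarrow> ennreal" where
  "path_weight \<tau> a b xs = (\<integral>\<^sup>+\<omega>. ennreal (exp (a * X (xs ! 1) \<omega> + b * X (xs ! 0) \<omega>) *
      of_bool (\<forall>v\<in>set xs. X v \<omega> \<le> \<tau>)) \<partial>M)"

lemma gaussian_sum_add: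
  assumes "finite A" "finite B"
  shows "centered_gaussian M (\<lambda>\<omega>. (\<Sum>v\<in>A. c v * X v \<omega>) + (\<Sum>v\<in>B. d v * X v \<omega>))"
proof -
  have ext: "(\<Sum>v\<in>C. c v * X v \<omega>) = (\<Sum>v\<in>A \<union> B. (if v \<in> C then c v else 0) * X v \<omega>)"
    if "C \<subseteq> A \<union> B" for C c \<omega>
    using that assms by (intro sum.mono_neutral_cong_left) auto
  have "(\<Sum>v\<in>A. c v * X v \<omega>) + (\<Sum>v\<in>B. d v * X v \<omega>)
      = (\<Sum>v\<in>A \<union> B. ((if v \<in> A then c v else 0) + (if v \<in> B then d v else 0)) * X v \<omega>)" for \<omega>
    by (simp add: ext[of A] ext[of B] sum.distrib[symmetric] distrib_right)
  then show ?thesis using assms by (simp add: gaussian_sum)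
qed

text \<open>The newest value is \<open>m + e\<close>, where \<open>m\<close> depends on the older
  values and \<open>e\<close> is independent of them. Integrating out \<open>e\<close> costs
  \<open>step_const \<tau> b\<close> and leaves \<open>exp (- 2 * m)\<close>, that is
  \<open>exp (2 * sqrt 2 * X y \<omega> + X x \<omega>)\<close>; so the exponents
  \<open>(a, b)\<close> become \<open>(1, a + 2 * sqrt 2)\<close>.\<close>

lemma path_weight_step:
  assumes walk: "nb_walk adj (w # y # x # zs)" and b: "b \<ge> 0"
  shows "path_weight \<tau> a b (w # y # x # zs)
    \<le> ennreal (step_const \<tau> b) * path_weight \<tau> 1 (a + 2 * sqrt 2) (y # x # zs)"
proof -
  define P where "P = set (y # x # zs)"
  have fin: "finite P" and yP: "y \<in> P" and xP: "x \<in> P" by (auto simp: P_def)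
  have adjs: "adj y w" "adj y x" "x \<noteq> w"
    using walk by (auto intro: adj_sym simp: nb_walk_Cons_Cons)
  have "card (neighbors adj y - {x, w}) = 1"
    using card_neighbors[of y] adjs by (subst card_Diff_subset) (auto simp: neighbors_def)
  then obtain w' where "neighbors adj y - {x, w} = {w'}" by (auto simp: card_1_singleton_iff)
  then have nb: "neighbors adj y = {x, w, w'}" and ne: "x \<noteq> w'" "w \<noteq> w'"
    using adjs by (auto simp: neighbors_def)
  have adj': "adj y w'" using nb by (auto simp: neighbors_def)
  define e where "e \<omega> = (X w \<omega> - X w' \<omega>) / 2" for \<omega>
  have e_meas[measurable]: "e \<in> borel_measurable M" unfolding e_def by measurable
  have e_sum: "r * e \<omega> = (\<Sum>v\<in>{w, w'}. (if v = w then r / 2 else - r / 2) * X v \<omega>)" for r \<omega>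
    using ne by (simp add: e_def field_simps)
  have e_sq: "(e \<omega>)\<^sup>2 = (X w \<omega> * X w \<omega> + X w' \<omega> * X w' \<omega> - 2 * (X w \<omega> * X w' \<omega>)) / 4" for \<omega>
    by (simp add: e_def power2_eq_square field_simps)
  \<comment> \<open>Unit variances and the sibling covariance \<open>5 / 6\<close> give
    \<open>(2 - 5 / 3) / 4 = 1 / 12\<close>.\<close>
  have "expectation (\<lambda>\<omega>. (e \<omega>)\<^sup>2) = (cov w w + cov w' w' - 2 * cov w w') / 4"
    unfolding e_sq cov_def by (simp add: integrable_XX)
  then have var_e: "expectation (\<lambda>\<omega>. (e \<omega>)\<^sup>2) = 1 / 12"
    using cov_dist_2[OF nb adjs(3) ne] by (simp add: cov_self)
  have gauss_e: "centered_gaussian M e"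
  proof -
    have "centered_gaussian M (\<lambda>\<omega>. 1 * e \<omega>)" unfolding e_sum by (rule gaussian_sum) simp
    then show ?thesis by simp
  qed
  have dist_e: "distributed M lborel e (normal_density 0 (sqrt (1 / 12)))"
    using centered_gaussian_distributed[OF gauss_e var_e] by simp
  have int_e: "integrable M (\<lambda>\<omega>. X v \<omega> * e \<omega>)" for v
  proof -
    have *: "X v \<omega> * e \<omega> = (X v \<omega> * X w \<omega> - X v \<omega> * X w' \<omega>) / 2" for \<omega>
      by (simp add: e_def field_simps)
    show ?thesis unfolding * using integrable_XX by simp
  qed
  have orth: "expectation (\<lambda>\<omega>. X v \<omega> * e \<omega>) = 0" if "v \<in> P" for v
  proof -
    have *: "X v \<omega> * e \<omega> = (X v \<omega> * X w \<omega> - X v \<omega> * X w' \<omega>) / 2" for \<omega>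
      by (simp add: e_def field_simps)
    have "expectation (\<lambda>\<omega>. X v \<omega> * e \<omega>) = (cov v w - cov v w') / 2"
      unfolding * by (simp add: cov_def integrable_XX)
    moreover have "cov v w = cov v w'"
      using walk adjs adj' ne that unfolding P_def
      by (intro cov_siblings[of y w w' "x # zs"]) (auto dest: nb_walk_tl)
    ultimately show ?thesis by simp
  qed
  \<comment> \<open>Orthogonality removes the cross terms, so the second moment grows by
    \<open>r\<^sup>2 / 12\<close>, half of which enters the exponent.\<close>
  have factor: "expectation (\<lambda>\<omega>. cos ((\<Sum>v\<in>P. c v * X v \<omega>) + r * e \<omega> + \<theta>))
      = exp (- r\<^sup>2 / 24) * expectation (\<lambda>\<omega>. cos ((\<Sum>v\<in>P. c v * X v \<omega>) + \<theta>))" for c r \<theta>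
  proof -
    let ?L = "\<lambda>\<omega>. \<Sum>v\<in>P. c v * X v \<omega>"
    have gL: "centered_gaussian M ?L" using gaussian_sum[OF fin] .
    have gLe: "centered_gaussian M (\<lambda>\<omega>. ?L \<omega> + r * e \<omega>)"
      unfolding e_sum using fin by (intro gaussian_sum_add) auto
    have sq: "(?L \<omega> + r * e \<omega>)\<^sup>2
        = (?L \<omega>)\<^sup>2 + (\<Sum>v\<in>P. 2 * r * c v * (X v \<omega> * e \<omega>)) + r\<^sup>2 * (e \<omega>)\<^sup>2" for \<omega>
      by (simp add: power2_sum power_mult_distrib sum_distrib_left sum_distrib_right mult_ac)
    have "expectation (\<lambda>\<omega>. (?L \<omega> + r * e \<omega>)\<^sup>2) = expectation (\<lambda>\<omega>. (?L \<omega>)\<^sup>2)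
        + (\<Sum>v\<in>P. 2 * r * c v * expectation (\<lambda>\<omega>. X v \<omega> * e \<omega>)) + r\<^sup>2 * expectation (\<lambda>\<omega>. (e \<omega>)\<^sup>2)"
      unfolding sq using int_e centered_gaussian_moments(2)[OF gL] centered_gaussian_moments(2)[OF gauss_e]
      by simp
    also have "\<dots> = expectation (\<lambda>\<omega>. (?L \<omega>)\<^sup>2) + r\<^sup>2 / 12" by (simp add: orth var_e)
    finally have "expectation (\<lambda>\<omega>. (?L \<omega> + r * e \<omega>)\<^sup>2) = expectation (\<lambda>\<omega>. (?L \<omega>)\<^sup>2) + r\<^sup>2 / 12" .
    then show ?thesis
      unfolding centered_gaussian_moments(4)[OF gL] centered_gaussian_moments(4)[OF gLe]
      by (simp add: exp_add[symmetric] add_divide_distrib)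
  qed
  let ?Q = "PiM P (\<lambda>_. borel :: real measure)"
  let ?U = "\<lambda>\<omega>. \<lambda>v\<in>P. X v \<omega>"
  have U[measurable]: "?U \<in> measurable M ?Q" by measurable
  have prod: "distr M ?Q ?U \<Otimes>\<^sub>M distr M borel e = distr M (?Q \<Otimes>\<^sub>M borel) (\<lambda>\<omega>. (?U \<omega>, e \<omega>))"
    by (rule distr_pair_if_cos_factorizes[OF fin X_measurable e_meas factor])
  \<comment> \<open>By the eigenvector equation at \<open>y\<close>, this is the half-sum of
    \<open>X w\<close> and \<open>X w'\<close>; adding the half-difference \<open>e\<close> recovers
    \<open>X w\<close>.\<close>
  define m where "m u = - sqrt 2 * u y - u x / 2" for u :: "'v \<Rightarrow> real"
  define g where "g u = ennreal (exp (a * u y) * of_bool (\<forall>v\<in>P. u v \<le> \<tau>))" for u :: "'v \<Rightarrow> real"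
  define h where "h u t = ennreal (exp (b * (m u + t)) * of_bool (m u + t \<le> \<tau>))" for u :: "'v \<Rightarrow> real" and t
  have comp[measurable]: "(\<lambda>u. u v) \<in> borel_measurable ?Q" if "v \<in> P" for v
    using that by (rule measurable_component_singleton)
  have [measurable]: "(\<lambda>u. u y) \<in> borel_measurable ?Q" "(\<lambda>u. u x) \<in> borel_measurable ?Q"
    using comp yP xP by auto
  have m_meas[measurable]: "m \<in> borel_measurable ?Q" unfolding m_def by measurable
  have "Measurable.pred ?Q (\<lambda>u. \<forall>v\<in>P. u v \<le> \<tau>)"
  proof (rule pred_intros_finite(3)[OF fin])
    fix v assume "v \<in> P"
    from comp[OF this] show "Measurable.pred ?Q (\<lambda>u. u v \<le> \<tau>)" by measurable
  qed
  then have g_meas[measurable]: "g \<in> borel_measurable ?Q" unfolding g_def by measurable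
  have h_meas[measurable]: "(\<lambda>(u, t). h u t) \<in> borel_measurable (?Q \<Otimes>\<^sub>M borel)"
    unfolding h_def by measurable
  have inner: "(\<integral>\<^sup>+t. h u t \<partial>distr M borel e) \<le> ennreal (step_const \<tau> b * exp (- 2 * m u))" for u
  proof -
    have "distr M borel e = distr M lborel e" by (intro distr_cong) auto
    also have "\<dots> = density lborel (normal_density 0 (sqrt (1 / 12)))"
      by (rule distributed_distr_eq_density[OF dist_e])
    finally have "(\<integral>\<^sup>+t. h u t \<partial>distr M borel e)
        = (\<integral>\<^sup>+t. ennreal (normal_density 0 (sqrt (1 / 12)) t) * h u t \<partial>lborel)"
      by (simp add: nn_integral_density h_def)
    then show ?thesis using normal_exp_bound[OF b, where m = "m u" and \<tau> = \<tau>] by (simp add: h_def)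
  qed
  interpret E: prob_space "distr M borel e" by (rule prob_space_distr) simp
  have "path_weight \<tau> a b (w # y # x # zs) = (\<integral>\<^sup>+\<omega>. g (?U \<omega>) * h (?U \<omega>) (e \<omega>) \<partial>M)"
    unfolding path_weight_def
  proof (rule nn_integral_cong_AE)
    show "AE \<omega> in M. ennreal (exp (a * X ((w # y # x # zs) ! 1) \<omega> + b * X ((w # y # x # zs) ! 0) \<omega>) *
        of_bool (\<forall>v\<in>set (w # y # x # zs). X v \<omega> \<le> \<tau>)) = g (?U \<omega>) * h (?U \<omega>) (e \<omega>)"
      using eigen
    proof eventually_elim
      case (elim \<omega>)
      have "X x \<omega> + (X w \<omega> + X w' \<omega>) = - 2 * sqrt 2 * X y \<omega>"
        using spec[OF elim, of y] nb ne adjs(3) by simp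
      then have "m (?U \<omega>) + e \<omega> = X w \<omega>" using xP yP by (simp add: m_def e_def field_simps)
      moreover have "(\<forall>v\<in>set (w # y # x # zs). X v \<omega> \<le> \<tau>) \<longleftrightarrow> (\<forall>v\<in>P. X v \<omega> \<le> \<tau>) \<and> X w \<omega> \<le> \<tau>"
        by (auto simp: P_def)
      ultimately show ?case
        using yP by (simp add: g_def h_def ennreal_mult'[symmetric] exp_add mult_ac)
    qed
  qed
  also have "\<dots> = (\<integral>\<^sup>+p. g (fst p) * h (fst p) (snd p) \<partial>distr M (?Q \<Otimes>\<^sub>M borel) (\<lambda>\<omega>. (?U \<omega>, e \<omega>)))"
    by (subst nn_integral_distr) (auto simp: split_beta')
  \<comment> \<open>By independence the joint law is the product law, so \<open>e\<close> can be
    integrated first, with the older values fixed.\<close>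
  also have "\<dots> = (\<integral>\<^sup>+u. \<integral>\<^sup>+t. g u * h u t \<partial>distr M borel e \<partial>distr M ?Q ?U)"
    unfolding prod[symmetric]
    by (subst E.nn_integral_fst[symmetric]) (auto simp: split_beta')
  also have "\<dots> = (\<integral>\<^sup>+\<omega>. \<integral>\<^sup>+t. g (?U \<omega>) * h (?U \<omega>) t \<partial>distr M borel e \<partial>M)"
    by (subst nn_integral_distr) (auto simp: split_beta')
  also have "\<dots> \<le> (\<integral>\<^sup>+\<omega>. ennreal (step_const \<tau> b) * ennreal (exp (1 * X ((y # x # zs) ! 1) \<omega>
      + (a + 2 * sqrt 2) * X ((y # x # zs) ! 0) \<omega>) * of_bool (\<forall>v\<in>set (y # x # zs). X v \<omega> \<le> \<tau>)) \<partial>M)"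
  proof (intro nn_integral_mono)
    fix \<omega> assume "\<omega> \<in> space M"
    then have "?U \<omega> \<in> space ?Q" by (rule measurable_space[OF U])
    then have [measurable]: "h (?U \<omega>) \<in> borel_measurable borel" unfolding h_def by measurable
    have "(\<integral>\<^sup>+t. g (?U \<omega>) * h (?U \<omega>) t \<partial>distr M borel e)
        = g (?U \<omega>) * (\<integral>\<^sup>+t. h (?U \<omega>) t \<partial>distr M borel e)"
      by (rule nn_integral_cmult) simp
    also have "\<dots> \<le> g (?U \<omega>) * ennreal (step_const \<tau> b * exp (- 2 * m (?U \<omega>)))"
      by (intro mult_left_mono inner) simp
    also have "\<dots> = ennreal (step_const \<tau> b) * ennreal (exp (1 * X x \<omega> + (a + 2 * sqrt 2) * X y \<omega>) *
        of_bool (\<forall>v\<in>P. X v \<omega> \<le> \<tau>))"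
    proof -
      have "exp (a * X y \<omega>) * exp (- 2 * m (?U \<omega>)) = exp (1 * X x \<omega> + (a + 2 * sqrt 2) * X y \<omega>)"
        unfolding exp_add[symmetric] using xP yP
        by (intro arg_cong[where f = exp]) (simp add: m_def algebra_simps)
      then show ?thesis
        using yP b by (simp add: g_def ennreal_mult'[symmetric] ennreal_mult''[symmetric] mult_ac step_const_def)
    qed
    finally show "(\<integral>\<^sup>+t. g (?U \<omega>) * h (?U \<omega>) t \<partial>distr M borel e) \<le> ennreal (step_const \<tau> b)
      * ennreal (exp (1 * X ((y # x # zs) ! 1) \<omega> + (a + 2 * sqrt 2) * X ((y # x # zs) ! 0) \<omega>)
        * of_bool (\<forall>v\<in>set (y # x # zs). X v \<omega> \<le> \<tau>))"
      by (simp add: P_def)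
  qed
  also have "\<dots> = ennreal (step_const \<tau> b) * path_weight \<tau> 1 (a + 2 * sqrt 2) (y # x # zs)"
    unfolding path_weight_def by (intro nn_integral_cmult) measurable
  finally show ?thesis .
qed

text \<open>Two steps turn the exponents \<open>(0, 0)\<close> into \<open>(1, 1 + 2 * sqrt 2)\<close>, a fixed point of
  \<open>(a, b) \<mapsto> (1, a + 2 * sqrt 2)\<close>.\<close>

definition decay :: real where
  "decay = step_const 0.086 (1 + 2 * sqrt 2)"

lemma path_weight_decay:
  assumes "nb_walk adj xs" "length xs = n + 2"
  shows "path_weight 0.086 1 (1 + 2 * sqrt 2) xs \<le> ennreal (exp ((2 + 2 * sqrt 2) * 0.086) * decay ^ n)"
  using assms
proof (induction n arbitrary: xs)
  case 0
  \<comment> \<open>Two vertices are too few for another step. Both exponents are positive, so the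
    exponential is at most its value at the threshold.\<close>
  have "path_weight 0.086 1 (1 + 2 * sqrt 2) xs \<le> (\<integral>\<^sup>+\<omega>. ennreal (exp ((2 + 2 * sqrt 2) * 0.086)) \<partial>M)"
    unfolding path_weight_def
  proof (intro nn_integral_mono ennreal_leI)
    fix \<omega>
    show "exp (1 * X (xs ! 1) \<omega> + (1 + 2 * sqrt 2) * X (xs ! 0) \<omega>) * of_bool (\<forall>v\<in>set xs. X v \<omega> \<le> 0.086)
        \<le> exp ((2 + 2 * sqrt 2) * 0.086)"
    proof (cases "\<forall>v\<in>set xs. X v \<omega> \<le> 0.086")
      case True
      then have "X (xs ! 1) \<omega> \<le> 0.086" "X (xs ! 0) \<omega> \<le> 0.086" using 0 by auto
      then have "1 * X (xs ! 1) \<omega> + (1 + 2 * sqrt 2) * X (xs ! 0) \<omega> \<le> 1 * 0.086 + (1 + 2 * sqrt 2) * 0.086"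
        by (intro add_mono mult_left_mono) auto
      also have "\<dots> = (2 + 2 * sqrt 2) * 0.086" by (simp add: algebra_simps)
      finally have "exp (1 * X (xs ! 1) \<omega> + (1 + 2 * sqrt 2) * X (xs ! 0) \<omega>) \<le> exp ((2 + 2 * sqrt 2) * 0.086)"
        by (simp only: exp_le_cancel_iff)
      then show ?thesis by (rule order_trans[OF mult_right_le_one_le, rotated 3]) auto
    next
      case False
      then show ?thesis by (subst of_bool_eq_0_iff[THEN iffD2]) auto
    qed
  qed
  then show ?case by (simp add: emeasure_space_1)
next
  case (Suc n)
  then obtain w y x zs where xs: "xs = w # y # x # zs"
    by (auto simp: length_Suc_conv)
  have "path_weight 0.086 1 (1 + 2 * sqrt 2) xs
      \<le> ennreal decay * path_weight 0.086 1 (1 + 2 * sqrt 2) (y # x # zs)"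
    unfolding xs decay_def using Suc.prems by (intro path_weight_step) (auto simp: xs)
  also have "\<dots> \<le> ennreal decay * ennreal (exp ((2 + 2 * sqrt 2) * 0.086) * decay ^ n)"
    using Suc.prems xs by (intro mult_left_mono Suc.IH) (auto dest: nb_walk_tl)
  also have "\<dots> = ennreal (exp ((2 + 2 * sqrt 2) * 0.086) * decay ^ Suc n)"
    by (subst ennreal_mult[symmetric]) (auto simp: decay_def step_const_def mult_ac)
  finally show ?case .
qed

section \<open>Probability of a long walk below the threshold\<close>

definition decay_const :: real where
  "decay_const = step_const 0.086 0 * step_const 0.086 (2 * sqrt 2) * exp ((2 + 2 * sqrt 2) * 0.086)"

text \<open>The probability is the weight with exponents \<open>(0, 0)\<close>. Two steps lead
  through \<open>(1, 2 * sqrt 2)\<close> to the fixed point, and two vertices remain for the final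
  pointwise bound; this explains the 4 and the three factors of \<open>decay_const\<close>.\<close>

lemma prob_walk:
  assumes walk: "nb_walk adj xs" and len: "length xs = n + 4"
  shows "prob {\<omega>\<in>space M. \<forall>v\<in>set xs. X v \<omega> \<le> 0.086} \<le> decay_const * decay ^ n"
proof -
  obtain u w y x zs where xs: "xs = u # w # y # x # zs"
    using len by (auto simp: length_Suc_conv numeral_eq_Suc)
  have walks: "nb_walk adj (w # y # x # zs)" "nb_walk adj (y # x # zs)"
    using walk xs by (auto dest: nb_walk_tl)
  have pos: "step_const 0.086 b \<ge> 0" if "b \<ge> 0" for b using that by (simp add: step_const_def)
  have [measurable]: "{\<omega>\<in>space M. \<forall>v\<in>set xs. X v \<omega> \<le> 0.086} \<in> sets M"
    by (intro sets.sets_Collect_finite_All) auto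
  have "emeasure M {\<omega>\<in>space M. \<forall>v\<in>set xs. X v \<omega> \<le> 0.086}
      = (\<integral>\<^sup>+\<omega>. indicator {\<omega>\<in>space M. \<forall>v\<in>set xs. X v \<omega> \<le> 0.086} \<omega> \<partial>M)"
    by (rule nn_integral_indicator[symmetric]) measurable
  also have "\<dots> = path_weight 0.086 0 0 xs"
    unfolding path_weight_def by (intro nn_integral_cong) (simp add: indicator_def)
  also have "\<dots> \<le> ennreal (step_const 0.086 0) * path_weight 0.086 1 (0 + 2 * sqrt 2) (w # y # x # zs)"
    unfolding xs using walk by (intro path_weight_step) (auto simp: xs)
  also have "\<dots> \<le> ennreal (step_const 0.086 0) * (ennreal (step_const 0.086 (0 + 2 * sqrt 2))
      * path_weight 0.086 1 (1 + 2 * sqrt 2) (y # x # zs))"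
    using walks by (intro mult_left_mono path_weight_step) auto
  also have "\<dots> \<le> ennreal (step_const 0.086 0) * (ennreal (step_const 0.086 (0 + 2 * sqrt 2))
      * ennreal (exp ((2 + 2 * sqrt 2) * 0.086) * decay ^ n))"
    using walks len xs by (intro mult_left_mono path_weight_decay) auto
  also have "\<dots> = ennreal (decay_const * decay ^ n)"
    using pos[of 0] pos[of "2 * sqrt 2"] pos[of "1 + 2 * sqrt 2"]
    by (simp add: ennreal_mult'[symmetric] decay_const_def mult_ac decay_def[symmetric])
  finally show ?thesis
    using pos by (simp add: emeasure_eq_measure decay_const_def decay_def)
qed

lemma decay_less: "0 \<le> decay" "decay < 49 / 100"
proof -
  have s: "1.414 \<le> sqrt 2" "sqrt 2 \<le> 1.415"
    by (rule real_le_rsqrt, simp add: power2_eq_square) (rule real_le_lsqrt; simp add: power2_eq_square)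
  have p: "0.72 \<le> sqrt (pi / 6)"
    using pi_approx by (intro real_le_rsqrt) (simp add: power2_eq_square)
  \<comment> \<open>The exponent in \<open>decay\<close> is at most \<open>7 / 10\<close>; its
    exponential is bounded through the tenth power, by
    \<open>2.72 ^ 7 \<le> 2.05 ^ 10\<close>.\<close>
  have "exp (7 / 10) ^ 10 = exp (1::real) ^ 7" by (simp add: exp_of_nat_mult[symmetric])
  also have "\<dots> \<le> 2.72 ^ 7" using e_less_272 by (intro power_mono) auto
  also have "\<dots> \<le> (2.05::real) ^ 10" by (simp add: power_divide)
  finally have e: "exp (7 / 10) \<le> (2.05::real)" by (subst (asm) power_mono_iff) auto
  have "exp (1 / 6 + (1 + 2 * sqrt 2 + 2) * 0.086) \<le> exp (7 / 10)"
    unfolding exp_le_cancel_iff using s by (simp add: field_simps)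
  also note e
  finally have num: "exp (1 / 6 + (1 + 2 * sqrt 2 + 2) * 0.086) \<le> 2.05" .
  \<comment> \<open>The number 5.828 is \<open>3 + 2 * 1.414\<close>.\<close>
  have "0.72 * 5.828 \<le> sqrt (pi / 6) * (1 + 2 * sqrt 2 + 2)" using s p by (intro mult_mono) auto
  then have "decay \<le> 2.05 / (0.72 * 5.828)"
    unfolding decay_def step_const_def using num by (intro frac_le) auto
  then show "decay < 49 / 100" by simp
  show "0 \<le> decay" by (simp add: decay_def step_const_def)
qed

section \<open>Almost sure finiteness of clusters and the density of the percolation\<close>

lemma finite_cluster_AE:
  assumes "\<tau> \<le> 0.086"
  shows "AE \<omega> in M. v \<in> percolation X \<tau> \<omega> \<longrightarrow>
    finite {u. (induced_adj adj (percolation X \<tau> \<omega>))\<^sup>*\<^sup>* v u}"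
proof -
  define A where "A xs = {\<omega>\<in>space M. \<forall>u\<in>set xs. X u \<omega> \<le> 0.086}" for xs
  \<comment> \<open>For every \<tau> up to 0.086 this measurable event contains the event that
    \<open>v\<close> lies in an infinite cluster. A walk with \<open>n + 3\<close> edges has the
    \<open>n + 4\<close> vertices required by \<open>prob_walk\<close>.\<close>
  define N where "N = (\<Inter>n. \<Union>xs\<in>walks v (n + 3). A xs)"
  have A[measurable]: "A xs \<in> sets M" for xs
    unfolding A_def by (intro sets.sets_Collect_finite_All) auto
  have UN[measurable]: "(\<Union>xs\<in>walks v n. A xs) \<in> sets M" for n
    using finite_walks by (intro sets.finite_UN) auto
  have N[measurable]: "N \<in> sets M" unfolding N_def by (intro sets.countable_INT) auto
  \<comment> \<open>A union bound over at most \<open>3 * 2 ^ (n + 3)\<close> walks gives the 24;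
    the ratio \<open>2 * decay\<close> is less than 1.\<close>
  have le: "prob N \<le> 24 * decay_const * (2 * decay) ^ n" for n
  proof -
    have "prob N \<le> prob (\<Union>xs\<in>walks v (n + 3). A xs)"
      by (intro finite_measure_mono) (auto simp: N_def)
    also have "\<dots> \<le> (\<Sum>xs\<in>walks v (n + 3). prob (A xs))"
      by (intro finite_measure_subadditive_finite finite_walks) auto
    also have "\<dots> \<le> (\<Sum>xs\<in>walks v (n + 3). decay_const * decay ^ n)"
      unfolding A_def by (intro sum_mono prob_walk) (auto simp: walks_def)
    also have "\<dots> = real (card (walks v (n + 3))) * (decay_const * decay ^ n)" by simp
    also have "\<dots> \<le> (3 * 2 ^ (n + 3)) * (decay_const * decay ^ n)"
    proof (intro mult_right_mono)
      have "real (card (walks v (n + 3))) \<le> real (3 * 2 ^ (n + 3))"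
        using card_walks by (intro of_nat_mono)
      then show "real (card (walks v (n + 3))) \<le> 3 * 2 ^ (n + 3)" by simp
      show "0 \<le> decay_const * decay ^ n"
        using decay_less by (simp add: decay_const_def step_const_def)
    qed
    finally show ?thesis by (simp add: power_add power_mult_distrib mult_ac)
  qed
  have "(\<lambda>n. 24 * decay_const * (2 * decay) ^ n) \<longlonglongrightarrow> 24 * decay_const * 0"
    using decay_less by (intro tendsto_mult tendsto_const LIMSEQ_power_zero) auto
  then have "prob N \<le> 24 * decay_const * 0" by (rule LIMSEQ_le_const) (use le in auto)
  then have "prob N = 0" using measure_nonneg[of M N] by simp
  then have "N \<in> null_sets M" using N by (simp add: null_setsI emeasure_eq_measure)
  then have "AE \<omega> in M. \<omega> \<notin> N" by (rule AE_not_in)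
  then show ?thesis
  proof (rule AE_mp, intro AE_I2 impI)
    fix \<omega> assume \<omega>: "\<omega> \<in> space M" "\<omega> \<notin> N" and v: "v \<in> percolation X \<tau> \<omega>"
    show "finite {u. (induced_adj adj (percolation X \<tau> \<omega>))\<^sup>*\<^sup>* v u}"
    proof (rule ccontr)
      assume "infinite {u. (induced_adj adj (percolation X \<tau> \<omega>))\<^sup>*\<^sup>* v u}"
      note long = long_walk_in_infinite_cluster[OF v this]
      have "\<omega> \<in> (\<Union>xs\<in>walks v (n + 3). A xs)" for n
        using long[of "n + 3"] \<omega>(1) assms unfolding A_def percolation_def by fastforce
      then show False using \<omega>(2) by (auto simp: N_def)
    qed
  qed
qed

lemma prob_below_threshold: "prob {\<omega>\<in>space M. X v \<omega> \<le> 0.086} > 0.534"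
proof -
  have "distributed M lborel (X v) std_normal_density"
    using centered_gaussian_distributed[OF gaussian_X[of v], of 1] cov_self[of v]
    by (simp add: cov_def power2_eq_square)
  from std_normal_cdf_ge[OF this, of "0.086"]
  have *: "prob {\<omega>\<in>space M. X v \<omega> \<le> 0.086} \<ge> 1 / 2 + 0.086 * std_normal_density 0.086" by simp
  \<comment> \<open>Together with \<open>1 + x \<le> exp x\<close> this gives a density of at least
    \<open>0.996 / 2.51\<close> at 0.086, which just suffices for 0.534.\<close>
  have "sqrt (2 * pi) \<le> 2.51"
    using pi_approx by (intro real_le_lsqrt) (auto simp: power2_eq_square)
  then have "1 / 2.51 \<le> 1 / sqrt (2 * pi)" by (intro frac_le) auto
  moreover have "0.996 \<le> exp (- (0.086)\<^sup>2 / 2 :: real)"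
    using exp_ge_add_one_self[of "- (0.086)\<^sup>2 / 2 :: real"] by (simp add: power2_eq_square)
  ultimately have "1 / 2.51 * 0.996 \<le> std_normal_density 0.086"
    unfolding std_normal_density_def by (intro mult_mono) auto
  then have "1 / 2 + 0.086 * (1 / 2.51 * 0.996) \<le> 1 / 2 + 0.086 * std_normal_density 0.086"
    by (intro add_left_mono mult_left_mono) auto
  moreover have "(0.534 :: real) < 1 / 2 + 0.086 * (1 / 2.51 * 0.996)" by simp
  ultimately show ?thesis using * by linarith
qed

end

theorem theorem5:
  fixes adj :: "'v graph" and M :: "'a measure" and X :: "'v \<Rightarrow> 'a \<Rightarrow> real"
  assumes "three_regular_tree adj"
    and "prob_space M"
    and "prob_space.gaussian_wave_function M adj (- 2 * sqrt 2) X"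
  shows "(\<forall>\<tau>::real. \<tau> \<le> 0.086 \<longrightarrow>
            (AE \<omega> in M. \<forall>C \<in> clusters adj (percolation X \<tau> \<omega>). finite C)) \<and>
         (\<forall>v. measure M {\<omega> \<in> space M. X v \<omega> \<le> 0.086} > 0.534)"
proof -
  interpret prob_space M by fact
  interpret wave M adj X
    by unfold_locales (use assms in auto)
  have "AE \<omega> in M. \<forall>C \<in> clusters adj (percolation X \<tau> \<omega>). finite C" if "\<tau> \<le> 0.086" for \<tau> :: real
  proof -
    \<comment> \<open>A cluster is the set reachable from one of its vertices. As there are
      countably many vertices, the exceptional null sets can be united.\<close>
    have "AE \<omega> in M. \<forall>v\<in>UNIV. v \<in> percolation X \<tau> \<omega> \<longrightarrow>
        finite {u. (induced_adj adj (percolation X \<tau> \<omega>))\<^sup>*\<^sup>* v u}"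
      using finite_cluster_AE[OF that] by (subst AE_ball_countable[OF countable_vertices]) auto
    then show ?thesis by eventually_elim (auto simp: clusters_def)
  qed
  then show ?thesis using prob_below_threshold by simp
qed

end
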